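(* For $\Gamma\in[1-2^{-12},1[$ let $f_\Gamma$ be the weak static solution constructed in the context. Then $$f_\Gamma\to f_{\rm Kurth}\quad\text{in}\quad L^1(\mathbb R^3\times\mathbb R^3)\quad\text{as}\quad\Gamma\nearrow1.$$
   Context: $x\wedge v$ is the cross product in $\mathbb R^3$; $]a,b]$, $[a,b[$ denote half-open intervals. The Kurth solution is $$f_{\rm Kurth}(x,v)=\frac{3}{4\pi^3}\,\frac{1}{(1-|x|^2-|v|^2+|x\wedge v|^2)^{1/2}}\quad\text{where } 1-|x|^2-|v|^2+|x\wedge v|^2>0\text{ and }|x\wedge v|<1,$$ and $f_{\rm Kurth}(x,v)=0$ elsewhere. Construction of $f_\Gamma$ for $\Gamma\in[1-2^{-12},1[$: let $R=2(1-\Gamma)^{1/3}$ and $h_c(z)=z\big(1-\frac{\Gamma}{1-z}\big)$ for $z\in\mathbb C$, $|z|\le R$ (it maps this disc into itself), with iterates $h_c^0(z)=z$, $h_c^k=h_c\circ h_c^{k-1}$. Let $\tilde\psi(z)=\sum_{k=0}^\infty h_c^k(z)$ for $|z|<R$ (a holomorphic function), and let $\psi(s)=\tilde\psi(s)$ for $s\in[0,1-\Gamma]$, $\psi(s)=s$ for $s\in[1-\Gamma,1]$. Let $\varphi=\varphi_\Gamma:[0,1]\to\mathbb R$ be given by $\varphi(0)=0$ and $\varphi(s)=\frac1{\pi^2}\frac{d}{ds}\int_0^s\frac{\psi(s-\sigma)}{\sqrt\sigma}\,d\sigma$ for $s\in]0,1]$; it is $C^\infty$ on $]0,1-\Gamma[$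 and on $]1-\Gamma,1]$. Finally, with $s(x,v)=1+|x\wedge v|^2-|x|^2-|v|^2$, $$f_\Gamma(x,v)=\frac{3}{4\pi}\,\varphi_\Gamma'(s(x,v))\quad\text{if } |x\wedge v|^2\le\Gamma\text{ and } s(x,v)\in]0,1]\setminus\{1-\Gamma\},$$ and $f_\Gamma(x,v)=0$ otherwise. *)

theory Defs
  imports "HOL-Analysis.Analysis"
begin

text \<open>All functions below are total. They are meaningful for \<open>1 - 2\<^sup>-\<^sup>1\<^sup>2 \<le> \<Gamma> < 1\<close> and on the
  domains given in the comments; values outside these domains never enter \<open>f_Gamma\<close>.\<close>

definition R_rad :: "real \<Rightarrow> real" where
  "R_rad \<Gamma> = 2 * root 3 (1 - \<Gamma>)"

text \<open>Domain: \<open>norm z \<le> R_rad \<Gamma>\<close>.\<close>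
definition h_c :: "real \<Rightarrow> complex \<Rightarrow> complex" where
  "h_c \<Gamma> z = z * (1 - of_real \<Gamma> / (1 - z))"

text \<open>Domain: \<open>norm z < R_rad \<Gamma>\<close>.\<close>
definition psi_tilde :: "real \<Rightarrow> complex \<Rightarrow> complex" where
  "psi_tilde \<Gamma> z = (\<Sum>k. (h_c \<Gamma> ^^ k) z)"

text \<open>Domain: \<open>{0..1}\<close>. Here \<open>psi_tilde\<close> is only used on \<open>{0..1 - \<Gamma>}\<close>, where
  \<open>1 - \<Gamma> < R_rad \<Gamma>\<close>. By \<open>h_c_iterate_Reals\<close> its series has real terms there, so
  \<open>Re\<close> is merely the conversion of types. By \<open>psi_tilde_gluing\<close> both branches agree
  at \<open>1 - \<Gamma>\<close>.\<close>
definition psi :: "real \<Rightarrow> real \<Rightarrow> real" where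
  "psi \<Gamma> s = (if s \<le> 1 - \<Gamma> then Re (psi_tilde \<Gamma> (of_real s)) else s)"

text \<open>Domain: \<open>{0..1}\<close>. The derivative is taken within this domain, hence is one-sided at \<open>s = 1\<close>;
  the integral is only evaluated for upper limits in \<open>{0..1}\<close>.\<close>
definition phi :: "real \<Rightarrow> real \<Rightarrow> real" where
  "phi \<Gamma> s = (if s = 0 then 0 else
     1 / pi\<^sup>2 * vector_derivative
       (\<lambda>t. integral {0..t} (\<lambda>\<sigma>. psi \<Gamma> (t - \<sigma>) / sqrt \<sigma>)) (at s within {0..1}))"

definition s_xv :: "real^3 \<Rightarrow> real^3 \<Rightarrow> real" where
  "s_xv x v = 1 + (norm (cross3 x v))\<^sup>2 - (norm x)\<^sup>2 - (norm v)\<^sup>2"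

definition f_Gamma :: "real \<Rightarrow> (real^3) \<times> (real^3) \<Rightarrow> real" where
  "f_Gamma \<Gamma> = (\<lambda>(x, v).
     if (norm (cross3 x v))\<^sup>2 \<le> \<Gamma> \<and> s_xv x v \<in> {0<..1} - {1 - \<Gamma>}
     then 3 / (4 * pi) * vector_derivative (phi \<Gamma>) (at (s_xv x v) within {0..1})
     else 0)"

definition f_Kurth :: "(real^3) \<times> (real^3) \<Rightarrow> real" where
  "f_Kurth = (\<lambda>(x, v).
     if 1 - (norm x)\<^sup>2 - (norm v)\<^sup>2 + (norm (cross3 x v))\<^sup>2 > 0 \<and> norm (cross3 x v) < 1
     then 3 / (4 * pi^3) *
       (1 / sqrt (1 - (norm x)\<^sup>2 - (norm v)\<^sup>2 + (norm (cross3 x v))\<^sup>2))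
     else 0)"

lemma h_c_iterate_Reals: "(h_c \<Gamma> ^^ k) (of_real s) \<in> \<real>"
  by (induction k) (auto simp: h_c_def)

lemma psi_tilde_gluing:
  assumes "\<Gamma> \<noteq> 0"
  shows "psi_tilde \<Gamma> (of_real (1 - \<Gamma>)) = of_real (1 - \<Gamma>)"
proof -
  have h1: "h_c \<Gamma> (of_real (1 - \<Gamma>)) = 0"
    using assms by (simp add: h_c_def)
  have h0: "(h_c \<Gamma> ^^ k) 0 = 0" for k
    by (induction k) (auto simp: h_c_def)
  have hS: "(h_c \<Gamma> ^^ k) (of_real (1 - \<Gamma>)) = 0" if "k \<noteq> 0" for k
    using that h0 h1 by (cases k) (simp_all add: funpow_swap1 del: of_real_diff)
  have "psi_tilde \<Gamma> (of_real (1 - \<Gamma>)) = (\<Sum>k\<in>{0}. (h_c \<Gamma> ^^ k) (of_real (1 - \<Gamma>)))"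
    unfolding psi_tilde_def by (rule suminf_finite) (use hS in auto)
  then show ?thesis by simp
qed

end

theory Submission
  imports Defs "HOL-Complex_Analysis.Complex_Analysis"
begin

text \<open>
  Put \<open>e = 1 - \<Gamma>\<close>. On \<open>{0..e}\<close> write \<open>\<psi> = id + g\<close>. On the disc of radius \<open>3 e\<close> the map
  \<open>h_c\<close> shrinks moduli at least by the factor \<open>8 e\<close>, so \<open>g\<close>, the sum of the iterates of positive order,
  is holomorphic there and \<open>O(e\<^sup>2)\<close>; Cauchy's estimates give \<open>g' = O(e)\<close> and \<open>g'' = O(1)\<close>.
  The identity contributes exactly the Kurth profile \<open>1 / (\<pi>\<^sup>2 \<surd>s)\<close> to \<open>\<phi>'\<close>, and \<open>g\<close>
  contributes at most \<open>O(e / \<surd>s)\<close> for \<open>s < e\<close> and \<open>O(e / \<surd>(s - e))\<close> for \<open>s > e\<close>.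
  On the support of these functions both \<open>x\<close> and \<open>v\<close> lie in the unit ball, and along a line in
  \<open>v\<close> parallel to \<open>x\<close> the function \<open>s\<close> is a quadratic polynomial with leading coefficient
  \<open>-1\<close>, so the integral of \<open>1 / \<surd>(s - \<delta>)\<close> along the line is at most \<open>\<pi>\<close>. Hence its
  integral over phase space is bounded uniformly in \<open>\<delta>\<close>. What remains is the Kurth density on
  \<open>\<Gamma> < |x \<wedge> v|\<^sup>2 < 1\<close> and on \<open>s = e\<close>, which vanishes in the limit by dominated convergence.
\<close>

subsection \<open>The correction to the identity in \<open>\<psi>\<close>\<close>

text \<open>Since \<open>1 - \<Gamma> / (1 - z) = (1 - \<Gamma> - z) / (1 - z)\<close>, the factor
  multiplying \<open>z\<close> has numerator at most \<open>4 * (1 - \<Gamma>)\<close> and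
  denominator at least \<open>1 / 2\<close> in modulus.\<close>

lemma norm_h_c_le:
  assumes "\<Gamma> \<in> {1 - 1 / 2 ^ 12..<1}" and "norm z \<le> 3 * (1 - \<Gamma>)"
  shows "norm (h_c \<Gamma> z) \<le> 8 * (1 - \<Gamma>) * norm z"
proof -
  have small: "norm z \<le> 1 / 2" using assms by auto
  have lower: "1 / 2 \<le> norm (1 - z)"
    using norm_triangle_ineq2[of 1 z] small by simp
  then have "1 - z \<noteq> 0" by auto
  then have h: "h_c \<Gamma> z = z * ((of_real (1 - \<Gamma>) - z) / (1 - z))"
    by (simp add: h_c_def field_simps)
  have "norm (of_real (1 - \<Gamma>) - z) \<le> norm (of_real (1 - \<Gamma>) :: complex) + norm z"
    by (rule norm_triangle_ineq4)
  also have "\<dots> \<le> (1 - \<Gamma>) + 3 * (1 - \<Gamma>)"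
    using assms by (simp only: norm_of_real) simp
  finally have upper: "norm (of_real (1 - \<Gamma>) - z) \<le> 4 * (1 - \<Gamma>)" by simp
  have "norm (of_real (1 - \<Gamma>) - z) / norm (1 - z) \<le> 4 * (1 - \<Gamma>) / (1 / 2)"
    using upper lower assms by (intro frac_le) auto
  then have "norm z * (norm (of_real (1 - \<Gamma>) - z) / norm (1 - z)) \<le> norm z * (8 * (1 - \<Gamma>))"
    by (intro mult_left_mono) auto
  then show ?thesis
    by (simp add: h norm_mult norm_divide mult_ac del: of_real_diff)
qed

lemma norm_h_c_iterate_le:
  assumes "\<Gamma> \<in> {1 - 1 / 2 ^ 12..<1}" and "norm z \<le> 3 * (1 - \<Gamma>)"
  shows "norm ((h_c \<Gamma> ^^ k) z) \<le> (8 * (1 - \<Gamma>)) ^ k * norm z"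
proof (induction k)
  case 0
  then show ?case by simp
next
  case (Suc k)
  \<comment> \<open>Since \<open>8 * (1 - \<Gamma>) \<le> 1\<close>, the iterates stay in the disc,
    so the one-step bound applies to each of them.\<close>
  have "(8 * (1 - \<Gamma>)) ^ k * norm z \<le> 1 * norm z"
    using assms(1) by (intro mult_right_mono power_le_one) auto
  with Suc assms have "norm ((h_c \<Gamma> ^^ k) z) \<le> 3 * (1 - \<Gamma>)" by linarith
  then have "norm ((h_c \<Gamma> ^^ Suc k) z) \<le> 8 * (1 - \<Gamma>) * norm ((h_c \<Gamma> ^^ k) z)"
    using norm_h_c_le[OF assms(1)] by simp
  also have "\<dots> \<le> 8 * (1 - \<Gamma>) * ((8 * (1 - \<Gamma>)) ^ k * norm z)"
    using Suc assms(1) by (intro mult_left_mono) auto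
  finally show ?case by (simp add: mult_ac)
qed

lemma holomorphic_h_c_iterate:
  assumes "\<Gamma> \<in> {1 - 1 / 2 ^ 12..<1}"
  shows "(h_c \<Gamma> ^^ k) holomorphic_on ball 0 (3 * (1 - \<Gamma>))"
proof (induction k)
  case 0
  then show ?case by (simp add: id_def)
next
  case (Suc k)
  \<comment> \<open>This keeps the denominator \<open>1 - (h_c \<Gamma> ^^ k) z\<close> of the next
    iterate away from zero.\<close>
  have "norm ((h_c \<Gamma> ^^ k) z) < 1" if "z \<in> ball 0 (3 * (1 - \<Gamma>))" for z
  proof -
    have z: "norm z < 3 * (1 - \<Gamma>)" using that by simp
    have "norm ((h_c \<Gamma> ^^ k) z) \<le> (8 * (1 - \<Gamma>)) ^ k * norm z"
      using norm_h_c_iterate_le[OF assms] z by simp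
    also have "\<dots> \<le> 1 * norm z"
      using assms by (intro mult_right_mono power_le_one) auto
    finally show ?thesis using z assms by simp
  qed
  then have "(\<lambda>z. (h_c \<Gamma> ^^ k) z * (1 - of_real \<Gamma> / (1 - (h_c \<Gamma> ^^ k) z)))
      holomorphic_on ball 0 (3 * (1 - \<Gamma>))"
    using Suc by (intro holomorphic_intros) force+
  then show ?case by (simp add: h_c_def[of \<Gamma> "(h_c \<Gamma> ^^ k) _"] o_def)
qed

text \<open>The correction \<open>g\<close> before restriction to the real axis: the series of
  \<open>psi_tilde\<close> without its term of order 0, which is the identity.\<close>

definition psi_tail :: "real \<Rightarrow> complex \<Rightarrow> complex" where
  "psi_tail \<Gamma> z = (\<Sum>k. (h_c \<Gamma> ^^ Suc k) z)"

text \<open>A summable majorant common to the whole disc. The first contraction is kept, as it makes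
  the tail quadratically small; the factors of the later ones are weakened to
  \<open>1 / 2\<close>.\<close>

lemma norm_h_c_iterate_Suc_le:
  assumes "\<Gamma> \<in> {1 - 1 / 2 ^ 12..<1}" and "norm z \<le> 3 * (1 - \<Gamma>)"
  shows "norm ((h_c \<Gamma> ^^ Suc k) z) \<le> 24 * (1 - \<Gamma>)\<^sup>2 * (1 / 2) ^ k"
proof -
  have "norm ((h_c \<Gamma> ^^ Suc k) z) \<le> (8 * (1 - \<Gamma>)) ^ Suc k * norm z"
    by (rule norm_h_c_iterate_le[OF assms])
  also have "\<dots> \<le> (8 * (1 - \<Gamma>)) ^ Suc k * (3 * (1 - \<Gamma>))"
    using assms by (intro mult_left_mono) auto
  also have "\<dots> = 24 * (1 - \<Gamma>)\<^sup>2 * (8 * (1 - \<Gamma>)) ^ k"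
    by (simp add: power2_eq_square algebra_simps)
  also have "\<dots> \<le> 24 * (1 - \<Gamma>)\<^sup>2 * (1 / 2) ^ k"
    using assms by (intro mult_left_mono power_mono) auto
  finally show ?thesis .
qed

lemma summable_majorant: "summable (\<lambda>k. c * (1 / 2) ^ k :: real)"
  by (intro summable_mult summable_geometric) simp

lemma summable_psi_tail:
  assumes "\<Gamma> \<in> {1 - 1 / 2 ^ 12..<1}" and "norm z \<le> 3 * (1 - \<Gamma>)"
  shows "summable (\<lambda>k. (h_c \<Gamma> ^^ Suc k) z)"
  by (rule summable_comparison_test'[OF summable_majorant norm_h_c_iterate_Suc_le[OF assms]])

lemma psi_tilde_eq_tail:
  assumes "\<Gamma> \<in> {1 - 1 / 2 ^ 12..<1}" and "norm z \<le> 3 * (1 - \<Gamma>)"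
  shows "psi_tilde \<Gamma> z = z + psi_tail \<Gamma> z"
proof -
  have "summable (\<lambda>k. (h_c \<Gamma> ^^ k) z)"
    using summable_psi_tail[OF assms] by (rule summable_Suc_iff[THEN iffD1])
  from suminf_split_head[OF this] show ?thesis
    by (simp add: psi_tilde_def psi_tail_def)
qed

lemma norm_psi_tail_le:
  assumes "\<Gamma> \<in> {1 - 1 / 2 ^ 12..<1}" and "norm z \<le> 3 * (1 - \<Gamma>)"
  shows "norm (psi_tail \<Gamma> z) \<le> 48 * (1 - \<Gamma>)\<^sup>2"
proof -
  have "norm (psi_tail \<Gamma> z) \<le> (\<Sum>k. 24 * (1 - \<Gamma>)\<^sup>2 * (1 / 2) ^ k)"
    unfolding psi_tail_def
    by (rule norm_suminf_le[OF norm_h_c_iterate_Suc_le[OF assms] summable_majorant])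
  also have "\<dots> = 48 * (1 - \<Gamma>)\<^sup>2"
    by (subst suminf_mult) (auto simp: suminf_geometric summable_geometric)
  finally show ?thesis .
qed

lemma holomorphic_psi_tail:
  assumes "\<Gamma> \<in> {1 - 1 / 2 ^ 12..<1}"
  shows "psi_tail \<Gamma> holomorphic_on ball 0 (3 * (1 - \<Gamma>))"
proof (rule holomorphic_uniform_sequence[OF open_ball])
  show "(\<lambda>z. \<Sum>k<n. (h_c \<Gamma> ^^ Suc k) z) holomorphic_on ball 0 (3 * (1 - \<Gamma>))" for n
    by (intro holomorphic_on_sum holomorphic_h_c_iterate assms)
next
  fix z :: complex assume "z \<in> ball 0 (3 * (1 - \<Gamma>))"
  then obtain d where d: "d > 0" "cball z d \<subseteq> ball 0 (3 * (1 - \<Gamma>))"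
    using open_contains_cball by blast
  have "uniform_limit (cball z d) (\<lambda>n w. \<Sum>k<n. (h_c \<Gamma> ^^ Suc k) w)
      (\<lambda>w. \<Sum>k. (h_c \<Gamma> ^^ Suc k) w) sequentially"
    using d(2) by (intro Weierstrass_m_test[OF norm_h_c_iterate_Suc_le[OF assms] summable_majorant])
      (metis less_imp_le mem_ball_0 subsetD)
  with d show "\<exists>d>0. cball z d \<subseteq> ball 0 (3 * (1 - \<Gamma>)) \<and>
      uniform_limit (cball z d) (\<lambda>n w. \<Sum>k<n. (h_c \<Gamma> ^^ Suc k) w) (psi_tail \<Gamma>) sequentially"
    unfolding psi_tail_def by blast
qed

text \<open>Collects all that the real-variable argument needs from complex analysis. The functions
  \<open>g\<close>, \<open>g1\<close>, \<open>g2\<close> are the real parts of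
  \<open>psi_tail\<close> and its first two derivatives on the real axis; Cauchy's inequality with
  radius \<open>1 - \<Gamma>\<close> bounds the derivatives.\<close>

lemma psi_decomposition:
  assumes \<Gamma>: "\<Gamma> \<in> {1 - 1 / 2 ^ 12..<1}"
  obtains g g1 g2 :: "real \<Rightarrow> real"
  where "\<And>s. s \<in> {0..1 - \<Gamma>} \<Longrightarrow> psi \<Gamma> s = s + g s" "g 0 = 0" "g (1 - \<Gamma>) = 0"
    "\<And>s. s \<in> {0..1 - \<Gamma>} \<Longrightarrow> (g has_real_derivative g1 s) (at s)"
    "\<And>s. s \<in> {0..1 - \<Gamma>} \<Longrightarrow> (g1 has_real_derivative g2 s) (at s)"
    "continuous_on {0..1 - \<Gamma>} g2"
    "\<And>s. s \<in> {0..1 - \<Gamma>} \<Longrightarrow> \<bar>g1 s\<bar> \<le> 48 * (1 - \<Gamma>)"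
    "\<And>s. s \<in> {0..1 - \<Gamma>} \<Longrightarrow> \<bar>g2 s\<bar> \<le> 96"
proof -
  define e where "e = 1 - \<Gamma>"
  have e: "e > 0" using \<Gamma> by (simp add: e_def)
  let ?F = "\<lambda>n s. Re ((deriv ^^ n) (psi_tail \<Gamma>) (of_real s))"
  have hol: "(deriv ^^ n) (psi_tail \<Gamma>) holomorphic_on ball 0 (3 * e)" for n
    unfolding e_def by (intro holomorphic_higher_deriv holomorphic_psi_tail \<Gamma> open_ball)
  have der: "(?F n has_real_derivative ?F (Suc n) s) (at s)" if "s \<in> {0..e}" for n s
  proof -
    have "((deriv ^^ n) (psi_tail \<Gamma>) has_field_derivative (deriv ^^ Suc n) (psi_tail \<Gamma>) (of_real s))
        (at (of_real s))"
      using holomorphic_derivI[OF hol open_ball, of "of_real s" n] that e by simp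
    from has_field_derivative_Re[OF has_vector_derivative_real_field[OF this]]
    show ?thesis .
  qed
  have bound: "\<bar>?F n s\<bar> \<le> fact n * (48 * e\<^sup>2) / e ^ n" if s: "s \<in> {0..e}" for n s
  proof -
    \<comment> \<open>The Cauchy disc of radius \<open>e\<close> about a point of
      \<open>{0..e}\<close> lies in the disc of radius \<open>2 * e\<close>; this is why the tail is
      studied up to radius \<open>3 * e\<close>.\<close>
    have sub: "norm z < 3 * e" if "z \<in> cball (of_real s) e" for z :: complex
      using that s e norm_triangle_ineq3[of z "of_real s"]
      by (auto simp: dist_norm norm_minus_commute)
    have "norm ((deriv ^^ n) (psi_tail \<Gamma>) (of_real s)) \<le> fact n * (48 * e\<^sup>2) / e ^ n"
    proof (rule Cauchy_inequality)
      have "cball (of_real s) e \<subseteq> ball (0::complex) (3 * e)" using sub by auto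
      with hol[of 0] show "continuous_on (cball (of_real s) e) (psi_tail \<Gamma>)"
          "psi_tail \<Gamma> holomorphic_on ball (of_real s) e"
        by (auto intro!: holomorphic_on_imp_continuous_on elim!: holomorphic_on_subset
            simp: ball_subset_cball subset_iff)
      show "norm (psi_tail \<Gamma> z) \<le> 48 * e\<^sup>2" if "norm (of_real s - z) = e" for z
        using norm_psi_tail_le[OF \<Gamma>, of z] sub[of z] that by (simp add: e_def dist_norm)
    qed (rule e)
    then show ?thesis using abs_Re_le_cmod order_trans by blast
  qed
  show ?thesis
  proof (rule that[of "?F 0" "?F 1" "?F 2"], unfold e_def[symmetric])
    show "psi \<Gamma> s = s + ?F 0 s" if "s \<in> {0..e}" for s
      using that psi_tilde_eq_tail[OF \<Gamma>, of "of_real s"] by (auto simp: psi_def e_def)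
    have "(h_c \<Gamma> ^^ k) 0 = 0" for k by (induction k) (auto simp: h_c_def)
    then show "?F 0 0 = 0" by (simp add: psi_tail_def del: funpow.simps)
    \<comment> \<open>By the gluing property \<open>psi_tilde\<close> fixes \<open>e\<close>, which
      leaves nothing for the tail.\<close>
    have "psi_tail \<Gamma> (of_real e) = 0"
      using psi_tilde_eq_tail[OF \<Gamma>, of "of_real e"] psi_tilde_gluing[of \<Gamma>] \<Gamma> e
      by (auto simp: e_def norm_of_real simp del: of_real_diff)
    then show "?F 0 e = 0" by simp
    show "(?F 0 has_real_derivative ?F 1 s) (at s)" if "s \<in> {0..e}" for s
      using der[OF that, of 0] by simp
    show "(?F 1 has_real_derivative ?F 2 s) (at s)" if "s \<in> {0..e}" for s
      using der[OF that, of 1] by (simp add: numeral_2_eq_2)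
    show "continuous_on {0..e} (?F 2)"
      by (rule DERIV_continuous_on[OF DERIV_subset[OF der]]) auto
    show "\<bar>?F 1 s\<bar> \<le> 48 * e" if "s \<in> {0..e}" for s
      using bound[OF that, of 1] e by (simp add: power2_eq_square)
    show "\<bar>?F 2 s\<bar> \<le> 96" if "s \<in> {0..e}" for s
      using bound[OF that, of 2] e by simp
  qed
qed

subsection \<open>Abel integrals\<close>

text \<open>The share of the identity in the Abel integral of \<open>psi\<close>; two derivatives in
  \<open>t\<close> turn it into the Kurth profile \<open>1 / sqrt t\<close>.\<close>

lemma has_integral_abel_id:
  fixes t :: real
  assumes "t \<ge> 0"
  shows "((\<lambda>\<sigma>. (t - \<sigma>) / sqrt \<sigma>) has_integral 4 / 3 * t * sqrt t) {0..t}"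
proof -
  let ?F = "\<lambda>\<sigma>. 2 * t * sqrt \<sigma> - 2 / 3 * \<sigma> * sqrt \<sigma>"
  have "((\<lambda>\<sigma>. (t - \<sigma>) / sqrt \<sigma>) has_integral (?F t - ?F 0)) {0..t}"
  proof (rule fundamental_theorem_of_calculus_interior[OF assms])
    show "continuous_on {0..t} ?F" by (intro continuous_intros)
    show "(?F has_vector_derivative (t - \<sigma>) / sqrt \<sigma>) (at \<sigma>)" if "\<sigma> \<in> {0<..<t}" for \<sigma>
      unfolding has_real_derivative_iff_has_vector_derivative[symmetric]
      using that by (auto intro!: derivative_eq_intros simp: field_simps)
  qed
  then show ?thesis by (simp add: algebra_simps)
qed

text \<open>The substitution \<open>\<sigma> = t q\<^sup>2\<close> removes the singularity of the Abel kernel and the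
  dependence of the domain on \<open>t\<close>.\<close>

lemma has_integral_abel_rescale:
  fixes f :: "real \<Rightarrow> real"
  assumes t: "t > 0" and f: "continuous_on {0..t} f"
  shows "((\<lambda>\<sigma>. f (t - \<sigma>) / sqrt \<sigma>) has_integral
    2 * sqrt t * integral {0..1} (\<lambda>q. f (t * (1 - q\<^sup>2)))) {0..t}"
proof -
  let ?h = "\<lambda>q. 2 * sqrt t * f (t * (1 - q\<^sup>2))"
  let ?k = "\<lambda>q. \<bar>2 * t * q\<bar> * (f (t - t * q\<^sup>2) / sqrt (t * q\<^sup>2))"
  have "continuous_on {0..1} ?h"
  proof (intro continuous_intros continuous_on_compose2[OF f])
    show "(\<lambda>q. t * (1 - q\<^sup>2)) ` {0..1} \<subseteq> {0..t}"
      using t by (auto intro!: mult_nonneg_nonneg simp: power_le_one mult_le_cancel_left1)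
  qed
  then have h: "?h absolutely_integrable_on {0..1}"
    by (rule absolutely_integrable_continuous_real)
  \<comment> \<open>The Jacobian cancels the singularity of the kernel. At \<open>q = 0\<close> the
    left side is 0 whatever \<open>f\<close> is, so that point is left out as a null set.\<close>
  have hk: "?k q = ?h q" if "q \<in> {0..1} - {0}" for q
  proof -
    obtain r where r: "r > 0" "t = r\<^sup>2"
      using t by (intro that[of "sqrt t"]) auto
    have q: "q > 0" using that by auto
    have "\<bar>2 * t * q\<bar> = 2 * r * (r * q)" "sqrt (t * q\<^sup>2) = r * q" "sqrt t = r"
      using r q by (auto simp: real_sqrt_mult abs_mult power2_eq_square)
    then have "?k q = 2 * r * (r * q) * (f (t - t * q\<^sup>2) / (r * q))"
      by (simp only:)
    also have "\<dots> = 2 * r * f (t - t * q\<^sup>2)"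
      using r(1) q by simp
    also have "\<dots> = ?h q"
      by (simp only: \<open>sqrt t = r\<close> Rings.right_diff_distrib mult_1_right)
    finally show ?thesis .
  qed
  have "?k absolutely_integrable_on {0..1}"
    using hk by (intro absolutely_integrable_spike[OF h, of "{0}"]) auto
  moreover have "integral {0..1} ?k = integral {0..1} ?h"
    using hk by (intro integral_spike[of "{0}"]) auto
  moreover have "(\<lambda>q. t * q\<^sup>2) ` {0..1} = {0..t}"
  proof safe
    fix x assume "x \<in> {0..t}"
    then show "x \<in> (\<lambda>q. t * q\<^sup>2) ` {0..1}"
      using t by (intro image_eqI[of _ _ "sqrt (x / t)"]) auto
  qed (use t in \<open>auto simp: power_le_one mult_le_cancel_left1\<close>)
  moreover have "inj_on (\<lambda>q. t * q\<^sup>2) {0..1}"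
    using t by (auto intro!: inj_onI)
  moreover have "((\<lambda>q. t * q\<^sup>2) has_field_derivative 2 * t * q) (at q within {0..1})" for q
    by (auto intro!: derivative_eq_intros)
  ultimately have "(\<lambda>\<sigma>. f (t - \<sigma>) / sqrt \<sigma>) absolutely_integrable_on {0..t} \<and>
      integral {0..t} (\<lambda>\<sigma>. f (t - \<sigma>) / sqrt \<sigma>) = integral {0..1} ?h"
    using has_absolute_integral_change_of_variables_1'
      [of "{0..1}" "\<lambda>q. t * q\<^sup>2" "\<lambda>q. 2 * t * q" "\<lambda>\<sigma>. f (t - \<sigma>) / sqrt \<sigma>" "integral {0..1} ?h"]
    by auto
  then show ?thesis
    using set_lebesgue_integral_eq_integral(1) by (auto simp: has_integral_iff)
qed

text \<open>Beyond \<open>e\<close> the correction enters only through arguments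
  \<open>u = t - \<sigma>\<close> in \<open>{0..e}\<close>, away from the singularity
  \<open>u = t\<close>. After the reflection the domain is fixed, and \<open>t\<close> occurs only
  in a kernel that is smooth there.\<close>

lemma has_integral_abel_reflect:
  fixes f :: "real \<Rightarrow> real"
  assumes "0 < e" "e < t" and f: "continuous_on {0..e} f"
  shows "((\<lambda>\<sigma>. (if t - \<sigma> \<le> e then f (t - \<sigma>) else 0) / sqrt \<sigma>) has_integral
    integral {0..e} (\<lambda>u. f u * (1 / sqrt (t - u)))) {0..t}"
proof -
  let ?h = "\<lambda>u. f u * (1 / sqrt (t - u))"
  have "continuous_on {0..e} ?h"
    using assms by (intro continuous_intros f) auto
  then have "(?h has_integral integral {0..e} ?h) (cbox 0 e)"
    by (simp add: integrable_continuous_real integrable_integral)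
  from has_integral_affinity[OF this, of "-1" t]
  have "((\<lambda>\<sigma>. ?h (t - \<sigma>)) has_integral integral {0..e} ?h) {t - e..t}"
    by (simp add: algebra_simps image_affinity_atLeastAtMost_diff image_affinity_atLeastAtMost)
  then have "((\<lambda>\<sigma>. if \<sigma> \<in> {t - e..t} then ?h (t - \<sigma>) else 0) has_integral integral {0..e} ?h) {0..t}"
    using assms by (subst has_integral_restrict) auto
  then show ?thesis
    by (rule has_integral_eq[rotated]) auto
qed

section \<open>Regularity and bounds of the rescaled and reflected integrals\<close>

lemma weight_in_unit: "q \<in> {0..1::real} \<Longrightarrow> 1 - q\<^sup>2 \<in> {0..1}"
  by (auto simp: power_le_one)

lemma mult_weight_in:
  fixes t e :: real
  assumes "t \<in> {0..e}" "q \<in> {0..1}"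
  shows "t * (1 - q\<^sup>2) \<in> {0..t}" "t * (1 - q\<^sup>2) \<in> {0..e}"
proof -
  show *: "t * (1 - q\<^sup>2) \<in> {0..t}"
    using assms weight_in_unit[of q] by (auto intro: mult_left_le)
  then show "t * (1 - q\<^sup>2) \<in> {0..e}" using assms by auto
qed

lemma continuous_on_weighted_integrand:
  fixes f :: "real \<Rightarrow> real"
  assumes "continuous_on {0..e} f"
  shows "continuous_on ({0..e} \<times> {0..1}) (\<lambda>(t, q). (1 - q\<^sup>2) ^ k * f (t * (1 - q\<^sup>2)))"
  unfolding split_beta
  by (intro continuous_intros continuous_on_compose2[OF assms]) (auto simp: mult_weight_in[simplified])

lemma continuous_on_weighted_integral:
  fixes f :: "real \<Rightarrow> real"
  assumes "continuous_on {0..e} f"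
  shows "continuous_on {0..e} (\<lambda>t. integral {0..1} (\<lambda>q. (1 - q\<^sup>2) ^ k * f (t * (1 - q\<^sup>2))))"
  using integral_continuous_on_param[OF continuous_on_weighted_integrand[OF assms, folded box_real(2)]]
  by simp

text \<open>The weight lies in \<open>{0..1}\<close> and the argument
  \<open>t * (1 - q\<^sup>2)\<close> in \<open>{0..t}\<close>. Bounding \<open>f\<close> on
  \<open>{0..t}\<close> only lets \<open>M\<close> depend on \<open>t\<close>, as in the later bound
  for \<open>g\<close> that is linear in \<open>t\<close>.\<close>

lemma abs_weighted_integral_le:
  fixes f :: "real \<Rightarrow> real"
  assumes "continuous_on {0..e} f" "t \<in> {0..e}" and M: "\<And>u. u \<in> {0..t} \<Longrightarrow> \<bar>f u\<bar> \<le> M"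
  shows "\<bar>integral {0..1} (\<lambda>q. (1 - q\<^sup>2) ^ k * f (t * (1 - q\<^sup>2)))\<bar> \<le> M"
proof -
  have "norm (integral {0..1} (\<lambda>q. (1 - q\<^sup>2) ^ k * f (t * (1 - q\<^sup>2)))) \<le> M * (1 - 0)"
  proof (rule integral_bound)
    show "continuous_on {0..1} (\<lambda>q. (1 - q\<^sup>2) ^ k * f (t * (1 - q\<^sup>2)))"
      using assms(2) by (intro continuous_intros continuous_on_compose2[OF assms(1)])
        (auto simp: mult_weight_in[simplified])
    show "norm ((1 - q\<^sup>2) ^ k * f (t * (1 - q\<^sup>2))) \<le> M" if "q \<in> {0..1}" for q
    proof -
      have "\<bar>(1 - q\<^sup>2) ^ k\<bar> \<le> 1"
        using weight_in_unit[OF that] by (auto simp: power_le_one)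
      then have "\<bar>(1 - q\<^sup>2) ^ k\<bar> * \<bar>f (t * (1 - q\<^sup>2))\<bar> \<le> 1 * M"
        using M[OF mult_weight_in(1)[OF assms(2) that]] by (intro mult_mono) auto
      then show ?thesis by (simp add: abs_mult)
    qed
  qed simp
  then show ?thesis by simp
qed

text \<open>Differentiation under the integral sign. The exponent \<open>k\<close> is general
  because each derivative in \<open>t\<close> brings out one more factor
  \<open>1 - q\<^sup>2\<close>.\<close>

lemma weighted_integral_derivative:
  fixes f f' :: "real \<Rightarrow> real"
  assumes f: "\<And>u. u \<in> {0..e} \<Longrightarrow> (f has_real_derivative f' u) (at u)"
    and f': "continuous_on {0..e} f'" and t: "t \<in> {0<..<e}"
  shows "((\<lambda>t. integral {0..1} (\<lambda>q. (1 - q\<^sup>2) ^ k * f (t * (1 - q\<^sup>2)))) has_real_derivative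
    integral {0..1} (\<lambda>q. (1 - q\<^sup>2) ^ Suc k * f' (t * (1 - q\<^sup>2)))) (at t)"
proof -
  have cont: "continuous_on {0..e} f"
    by (rule DERIV_continuous_on[OF DERIV_subset[OF f]]) auto
  have "((\<lambda>t. integral (cbox 0 1) (\<lambda>q. (1 - q\<^sup>2) ^ k * f (t * (1 - q\<^sup>2)))) has_field_derivative
    integral (cbox 0 1) (\<lambda>q. (1 - q\<^sup>2) ^ Suc k * f' (t * (1 - q\<^sup>2)))) (at t within {0..e})"
  proof (rule leibniz_rule_field_derivative)
    fix x q :: real assume xq: "x \<in> {0..e}" "q \<in> cbox 0 1"
    have "((\<lambda>x. f (x * (1 - q\<^sup>2))) has_real_derivative f' (x * (1 - q\<^sup>2)) * (1 - q\<^sup>2)) (at x within {0..e})"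
      using xq by (intro DERIV_chain2[OF f] mult_weight_in(2))
        (auto intro!: derivative_eq_intros)
    then show "((\<lambda>x. (1 - q\<^sup>2) ^ k * f (x * (1 - q\<^sup>2))) has_real_derivative
        (1 - q\<^sup>2) ^ Suc k * f' (x * (1 - q\<^sup>2))) (at x within {0..e})"
      by (auto intro!: derivative_eq_intros)
  next
    fix x assume "x \<in> {0..e}"
    then show "(\<lambda>q. (1 - q\<^sup>2) ^ k * f (x * (1 - q\<^sup>2))) integrable_on cbox 0 1"
      by (intro integrable_continuous continuous_intros continuous_on_compose2[OF cont])
        (auto simp: mult_weight_in[simplified])
  next
    show "continuous_on ({0..e} \<times> cbox 0 1) (\<lambda>(t, q). (1 - q\<^sup>2) ^ Suc k * f' (t * (1 - q\<^sup>2)))"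
      using continuous_on_weighted_integrand[OF f', of "Suc k"] by (simp del: power_Suc)
  qed (use t in auto)
  then show ?thesis
    using t at_within_Icc_at[of 0 t e] by simp
qed

lemma continuous_on_kernel_integral:
  fixes f k :: "real \<Rightarrow> real"
  assumes f: "continuous_on {0..e} f" and k: "continuous_on {0<..} k"
  shows "continuous_on {e<..} (\<lambda>t. integral {0..e} (\<lambda>u. f u * k (t - u)))"
proof -
  have "continuous_on ({e<..} \<times> {0..e}) (\<lambda>(t, u). f u * k (t - u))"
    unfolding split_beta
    by (intro continuous_intros continuous_on_compose2[OF f] continuous_on_compose2[OF k]) auto
  then show ?thesis
    using integral_continuous_on_param[of "{e<..}" 0 e] by simp
qed

text \<open>As \<open>t - u\<close> stays positive for \<open>u\<close> in \<open>{0..e}\<close>,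
  the derivative can fall on the kernel. The kernel is general because the lemma is applied twice,
  first to \<open>1 / sqrt r\<close> and then to its derivative.\<close>

lemma kernel_integral_derivative:
  fixes f k k' :: "real \<Rightarrow> real"
  assumes f: "continuous_on {0..e} f"
    and k: "\<And>r. r > 0 \<Longrightarrow> (k has_real_derivative k' r) (at r)"
    and k': "continuous_on {0<..} k'" and t: "e < t"
  shows "((\<lambda>t. integral {0..e} (\<lambda>u. f u * k (t - u))) has_real_derivative
    integral {0..e} (\<lambda>u. f u * k' (t - u))) (at t)"
proof -
  have contk: "continuous_on {0<..} k"
    by (rule DERIV_continuous_on[OF DERIV_subset[OF k]]) auto
  have "((\<lambda>t. integral (cbox 0 e) (\<lambda>u. f u * k (t - u))) has_field_derivative
    integral (cbox 0 e) (\<lambda>u. f u * k' (t - u))) (at t within {e<..})"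
  proof (rule leibniz_rule_field_derivative)
    fix x u :: real assume xu: "x \<in> {e<..}" "u \<in> cbox 0 e"
    have "((\<lambda>x. k (x - u)) has_real_derivative k' (x - u) * 1) (at x within {e<..})"
      using xu by (intro DERIV_chain2[OF k]) (auto intro!: derivative_eq_intros)
    then show "((\<lambda>x. f u * k (x - u)) has_real_derivative f u * k' (x - u)) (at x within {e<..})"
      by (auto intro!: derivative_eq_intros)
  next
    fix x assume "x \<in> {e<..}"
    then show "(\<lambda>u. f u * k (x - u)) integrable_on cbox 0 e"
      by (intro integrable_continuous continuous_intros continuous_on_compose2[OF contk])
        (auto simp: f)
  next
    show "continuous_on ({e<..} \<times> cbox 0 e) (\<lambda>(t, u). f u * k' (t - u))"
      unfolding split_beta
      by (intro continuous_intros continuous_on_compose2[OF f] continuous_on_compose2[OF k']) auto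
  qed (use t in auto)
  then show ?thesis
    using t at_within_open[of t "{e<..}"] by simp
qed

section \<open>The derivative of \<open>phi\<close>\<close>

text \<open>Reduces \<open>\<phi>'\<close> to differentiating a formula \<open>A\<close> for the
  Abel integral twice. The open set \<open>U\<close> may reach beyond 1, so that the one-sided
  derivatives at \<open>s = 1\<close> are restrictions of two-sided ones.\<close>

lemma phi_vector_derivative:
  assumes U: "open U" "U \<subseteq> {0<..}"
    and A: "\<And>t. t \<in> U \<Longrightarrow> integral {0..t} (\<lambda>\<sigma>. psi \<Gamma> (t - \<sigma>) / sqrt \<sigma>) = A t"
    and A1: "\<And>t. t \<in> U \<Longrightarrow> (A has_real_derivative A1 t) (at t)"
    and A2: "\<And>t. t \<in> U \<Longrightarrow> (A1 has_real_derivative A2 t) (at t)"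
    and s: "s \<in> U" "s \<le> 1"
  shows "vector_derivative (phi \<Gamma>) (at s within {0..1}) = A2 s / pi\<^sup>2"
proof -
  have phi: "phi \<Gamma> t = A1 t / pi\<^sup>2" if t: "t \<in> U" "t \<le> 1" for t
  proof -
    have "(A has_vector_derivative A1 t) (at t)"
      using A1[OF t(1)] by (simp add: has_real_derivative_iff_has_vector_derivative)
    then have "((\<lambda>t. integral {0..t} (\<lambda>\<sigma>. psi \<Gamma> (t - \<sigma>) / sqrt \<sigma>)) has_vector_derivative A1 t) (at t)"
      by (rule has_vector_derivative_transform_within_open[OF _ U(1) t(1)]) (simp add: A)
    from vector_derivative_at_within_ivl[OF this, of 0 1] show ?thesis
      using t U(2) by (force simp: phi_def)
  qed
  obtain r where r: "r > 0" "ball s r \<subseteq> U"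
    using U(1) s(1) open_contains_ball by blast
  have "((\<lambda>t. A1 t / pi\<^sup>2) has_vector_derivative A2 s / pi\<^sup>2) (at s within {0..1})"
    unfolding has_real_derivative_iff_has_vector_derivative[symmetric]
    by (intro DERIV_cdivide DERIV_subset[OF A2[OF s(1)]]) auto
  then have "(phi \<Gamma> has_vector_derivative A2 s / pi\<^sup>2) (at s within {0..1})"
  proof (rule has_vector_derivative_transform_within[OF _ r(1)])
    show "A1 x / pi\<^sup>2 = phi \<Gamma> x" if "x \<in> {0..1}" "dist x s < r" for x
      using that r(2) by (subst phi) (auto simp: dist_commute subset_iff)
  qed (use s U in auto)
  moreover have "s \<in> {0..1}" using s U by force
  ultimately show ?thesis
    using vector_derivative_within_cbox[of 0 1 s "phi \<Gamma>"] by simp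
qed

text \<open>Here \<open>d\<close> is the share of the correction \<open>g\<close>. Its measurability
  is needed because \<open>f_Gamma\<close> is later expressed through the composition of
  \<open>d\<close> with \<open>s_xv\<close>.\<close>

lemma phi_second_derivative:
  assumes \<Gamma>: "\<Gamma> \<in> {1 - 1 / 2 ^ 12..<1}"
  obtains d :: "real \<Rightarrow> real"
  where "d \<in> borel_measurable borel"
    "\<And>s. s \<in> {0<..1} - {1 - \<Gamma>} \<Longrightarrow>
      vector_derivative (phi \<Gamma>) (at s within {0..1}) = (1 / sqrt s + d s) / pi\<^sup>2"
    "\<And>s. s \<in> {0<..<1 - \<Gamma>} \<Longrightarrow> \<bar>d s\<bar> \<le> 312 * (1 - \<Gamma>) * (1 / sqrt s)"
    "\<And>s. s > 1 - \<Gamma> \<Longrightarrow> \<bar>d s\<bar> \<le> 312 * (1 - \<Gamma>) * (1 / sqrt (s - (1 - \<Gamma>)))"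
proof -
  obtain g g1 g2 :: "real \<Rightarrow> real"
  where psi: "\<And>s. s \<in> {0..1 - \<Gamma>} \<Longrightarrow> psi \<Gamma> s = s + g s"
    and g_ends: "g 0 = 0" "g (1 - \<Gamma>) = 0"
    and g: "\<And>s. s \<in> {0..1 - \<Gamma>} \<Longrightarrow> (g has_real_derivative g1 s) (at s)"
    and g1: "\<And>s. s \<in> {0..1 - \<Gamma>} \<Longrightarrow> (g1 has_real_derivative g2 s) (at s)"
    and cont_g2: "continuous_on {0..1 - \<Gamma>} g2"
    and g1_le: "\<And>s. s \<in> {0..1 - \<Gamma>} \<Longrightarrow> \<bar>g1 s\<bar> \<le> 48 * (1 - \<Gamma>)"
    and g2_le: "\<And>s. s \<in> {0..1 - \<Gamma>} \<Longrightarrow> \<bar>g2 s\<bar> \<le> 96"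
    using psi_decomposition[OF \<Gamma>] by metis
  define e where "e = 1 - \<Gamma>"
  have e: "e > 0" using \<Gamma> by (simp add: e_def)
  note [simp] = e_def[symmetric]
  note psi = psi[simplified] and g_ends = g_ends[simplified] and g = g[simplified] and g1 = g1[simplified]
    and cont_g2 = cont_g2[simplified] and g1_le = g1_le[simplified] and g2_le = g2_le[simplified]
  have cont_g: "continuous_on {0..e} g"
    by (rule DERIV_continuous_on[OF DERIV_subset[OF g]]) auto
  have cont_g1: "continuous_on {0..e} g1"
    by (rule DERIV_continuous_on[OF DERIV_subset[OF g1]]) auto
  \<comment> \<open>Combined with the zeros of \<open>g\<close> at 0 and \<open>e\<close>, this
    yields linear bounds for \<open>g\<close> near both endpoints.\<close>
  have lip: "\<bar>g y - g x\<bar> \<le> 48 * e * \<bar>y - x\<bar>" if "x \<in> {0..e}" "y \<in> {0..e}" for x y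
    using field_differentiable_bound[of "{0..e}" g g1 "48 * e" y x] that g1_le
    by (auto intro!: DERIV_subset[OF g])
  let ?W = "\<lambda>k f t. integral {0..1} (\<lambda>q. (1 - q\<^sup>2) ^ k * f (t * (1 - q\<^sup>2)))"
  let ?B = "?W 0 g" and ?B1 = "?W 1 g1" and ?B2 = "?W 2 g2"
  have B: "(?B has_real_derivative ?B1 t) (at t)" "(?B1 has_real_derivative ?B2 t) (at t)"
    if "t \<in> {0<..<e}" for t
    using weighted_integral_derivative[OF g cont_g1 that, of 0]
      weighted_integral_derivative[OF g1 cont_g2 that, of 1]
    by (simp_all add: numeral_2_eq_2)
  \<comment> \<open>The Abel integral of \<open>g\<close> is \<open>2 * sqrt t * ?B t\<close>.
    \<open>A1\<close> is the first derivative of the whole Abel integral, and \<open>d1\<close> the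
    second derivative of the share of \<open>g\<close>.\<close>
  define A1 where "A1 t = 2 * sqrt t + (?B t / sqrt t + 2 * sqrt t * ?B1 t)" for t
  define d1 where "d1 t = - ?B t / (2 * t * sqrt t) + 2 * ?B1 t / sqrt t + 2 * sqrt t * ?B2 t" for t
  have inner: "vector_derivative (phi \<Gamma>) (at s within {0..1}) = (1 / sqrt s + d1 s) / pi\<^sup>2"
    if s: "s \<in> {0<..<e}" "s \<le> 1" for s
  proof (rule phi_vector_derivative[OF open_greaterThanLessThan _ _ _ _ s])
    show "{0<..<e} \<subseteq> {0<..}" by auto
  next
    fix t assume t: "t \<in> {0<..<e}"
    have "((\<lambda>\<sigma>. (t - \<sigma>) / sqrt \<sigma> + g (t - \<sigma>) / sqrt \<sigma>) has_integral
        4 / 3 * t * sqrt t + 2 * sqrt t * ?B t) {0..t}"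
      using t has_integral_abel_rescale[of t g] continuous_on_subset[OF cont_g, of "{0..t}"]
      by (intro has_integral_add has_integral_abel_id) auto
    then have "((\<lambda>\<sigma>. psi \<Gamma> (t - \<sigma>) / sqrt \<sigma>) has_integral
        4 / 3 * t * sqrt t + 2 * sqrt t * ?B t) {0..t}"
      by (rule has_integral_eq[rotated]) (use t in \<open>auto simp: psi add_divide_distrib\<close>)
    then show "integral {0..t} (\<lambda>\<sigma>. psi \<Gamma> (t - \<sigma>) / sqrt \<sigma>) = 4 / 3 * t * sqrt t + 2 * sqrt t * ?B t"
      by (rule integral_unique)
  next
    fix t assume t: "t \<in> {0<..<e}"
    have "((\<lambda>t. 4 / 3 * t * sqrt t) has_real_derivative 2 * sqrt t) (at t)"
      using t by (auto intro!: derivative_eq_intros simp: field_simps)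
    moreover have "((\<lambda>t. 2 * sqrt t) has_real_derivative 1 / sqrt t) (at t)"
      using t by (auto intro!: derivative_eq_intros simp: field_simps)
    from DERIV_mult[OF this B(1)[OF t]]
    have "((\<lambda>t. 2 * sqrt t * ?B t) has_real_derivative ?B t / sqrt t + 2 * sqrt t * ?B1 t) (at t)"
      by (simp add: mult_ac)
    ultimately show "((\<lambda>t. 4 / 3 * t * sqrt t + 2 * sqrt t * ?B t) has_real_derivative A1 t) (at t)"
      unfolding A1_def by (rule DERIV_add)
    have sq: "((\<lambda>t. 2 * sqrt t) has_real_derivative 1 / sqrt t) (at t)"
      using t by (auto intro!: derivative_eq_intros simp: field_simps)
    have inv: "((\<lambda>t. 1 / sqrt t) has_real_derivative - 1 / (2 * t * sqrt t)) (at t)"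
      using t by (auto intro!: derivative_eq_intros simp: field_simps)
    have "((\<lambda>t. 2 * sqrt t + (1 / sqrt t * ?B t + 2 * sqrt t * ?B1 t)) has_real_derivative
        1 / sqrt t + ((- 1 / (2 * t * sqrt t) * ?B t + ?B1 t * (1 / sqrt t)) + (1 / sqrt t * ?B1 t + ?B2 t * (2 * sqrt t)))) (at t)"
      by (intro DERIV_add DERIV_mult sq inv B t)
    then show "(A1 has_real_derivative 1 / sqrt t + d1 t) (at t)"
      unfolding A1_def d1_def by (simp add: algebra_simps)
  qed
  have inner_le: "\<bar>d1 s\<bar> \<le> 312 * e * (1 / sqrt s)" if s: "s \<in> {0<..<e}" for s
  proof -
    \<comment> \<open>The zero of \<open>g\<close> at 0 supplies the factor \<open>s\<close> that
      reduces the singularity of order \<open>-3/2\<close> in \<open>d1\<close> to order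
      \<open>-1/2\<close>.\<close>
    have "\<bar>?B s\<bar> \<le> 48 * e * s"
    proof (rule abs_weighted_integral_le[OF cont_g])
      show "\<bar>g u\<bar> \<le> 48 * e * s" if "u \<in> {0..s}" for u
      proof -
        have "\<bar>g u\<bar> \<le> 48 * e * u" using lip[of 0 u] that s g_ends by auto
        also have "\<dots> \<le> 48 * e * s" using that e by (intro mult_left_mono) auto
        finally show ?thesis .
      qed
    qed (use s in auto)
    then have "\<bar>?B s\<bar> / (2 * s * sqrt s) \<le> 48 * e * s / (2 * s * sqrt s)"
      using s by (intro divide_right_mono) auto
    also have "\<dots> = 24 * e / sqrt s" using s by simp
    finally have 1: "\<bar>?B s / (2 * s * sqrt s)\<bar> \<le> 24 * e / sqrt s"
      using s by (simp add: abs_mult)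
    have "\<bar>?B1 s\<bar> \<le> 48 * e"
      using s by (intro abs_weighted_integral_le[OF cont_g1] g1_le) auto
    then have "\<bar>2 * ?B1 s / sqrt s\<bar> \<le> 2 * (48 * e) / sqrt s"
      using s by (simp add: abs_mult divide_right_mono)
    then have 2: "\<bar>2 * ?B1 s / sqrt s\<bar> \<le> 96 * e / sqrt s" by simp
    have "\<bar>?B2 s\<bar> \<le> 96"
      using s by (intro abs_weighted_integral_le[OF cont_g2] g2_le) auto
    then have "\<bar>2 * sqrt s * ?B2 s\<bar> \<le> 2 * sqrt s * 96"
      using s by (simp add: abs_mult mult_left_mono)
    moreover have "sqrt s \<le> e / sqrt s"
    proof -
      have "sqrt s = s / sqrt s" using s by (simp add: real_div_sqrt)
      also have "\<dots> \<le> e / sqrt s" using s by (intro divide_right_mono) auto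
      finally show ?thesis .
    qed
    ultimately have 3: "\<bar>2 * sqrt s * ?B2 s\<bar> \<le> 192 * (e / sqrt s)" by linarith
    \<comment> \<open>The constant 312 is \<open>24 + 96 + 192\<close>.\<close>
    have "\<bar>d1 s\<bar> \<le> 24 * e / sqrt s + 96 * e / sqrt s + 192 * (e / sqrt s)"
      unfolding d1_def using 1 2 3 by linarith
    then show ?thesis by (simp add: field_simps)
  qed
  have cont_d1: "continuous_on {0<..<e} d1"
    unfolding d1_def
    by (intro continuous_intros continuous_on_subset[OF continuous_on_weighted_integral[OF cont_g]]
        continuous_on_subset[OF continuous_on_weighted_integral[OF cont_g1]]
        continuous_on_subset[OF continuous_on_weighted_integral[OF cont_g2]]) auto

  \<comment> \<open>The Abel kernel and its first two derivatives.\<close>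
  define k0 k1 k2 :: "real \<Rightarrow> real"
    where "k0 r = 1 / sqrt r" and "k1 r = - 1 / (2 * r * sqrt r)"
      and "k2 r = 3 / (4 * r\<^sup>2 * sqrt r)" for r
  have k0: "(k0 has_real_derivative k1 r) (at r)" and k1: "(k1 has_real_derivative k2 r) (at r)"
    if "r > 0" for r
    unfolding k0_def[abs_def] k1_def[abs_def] k2_def using that
    by (auto intro!: derivative_eq_intros simp: field_simps power2_eq_square)
  \<comment> \<open>Serves to trade one order of the singularity against the linear vanishing of
    \<open>g\<close> at \<open>e\<close>.\<close>
  have k2_k1: "r * k2 r = - (3 / 2) * k1 r" if "r > 0" for r
    unfolding k1_def k2_def using that by (simp add: field_simps power2_eq_square)
  have cont_k1: "continuous_on {0<..} k1" and cont_k2: "continuous_on {0<..} k2"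
    unfolding k1_def[abs_def] k2_def[abs_def] by (auto intro!: continuous_intros)
  let ?K = "\<lambda>k t. integral {0..e} (\<lambda>u. g u * k (t - u))"
  define d2 where "d2 = ?K k2"
  have outer: "vector_derivative (phi \<Gamma>) (at s within {0..1}) = (1 / sqrt s + d2 s) / pi\<^sup>2"
    if s: "s \<in> {e<..}" "s \<le> 1" for s
  proof (rule phi_vector_derivative[OF open_greaterThan _ _ _ _ s])
    show "{e<..} \<subseteq> {0<..}" using e by auto
  next
    fix t assume t: "t \<in> {e<..}"
    have "((\<lambda>\<sigma>. (t - \<sigma>) / sqrt \<sigma> + (if t - \<sigma> \<le> e then g (t - \<sigma>) else 0) / sqrt \<sigma>) has_integral
        4 / 3 * t * sqrt t + ?K k0 t) {0..t}"
      using t e has_integral_abel_reflect[OF e _ cont_g, of t]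
      unfolding k0_def by (intro has_integral_add has_integral_abel_id) auto
    then have "((\<lambda>\<sigma>. psi \<Gamma> (t - \<sigma>) / sqrt \<sigma>) has_integral
        4 / 3 * t * sqrt t + ?K k0 t) {0..t}"
    proof (rule has_integral_eq[rotated])
      fix \<sigma> assume "\<sigma> \<in> {0..t}"
      then show "(t - \<sigma>) / sqrt \<sigma> + (if t - \<sigma> \<le> e then g (t - \<sigma>) else 0) / sqrt \<sigma> =
          psi \<Gamma> (t - \<sigma>) / sqrt \<sigma>"
        using psi[of "t - \<sigma>"] by (auto simp: psi_def add_divide_distrib)
    qed
    then show "integral {0..t} (\<lambda>\<sigma>. psi \<Gamma> (t - \<sigma>) / sqrt \<sigma>) = 4 / 3 * t * sqrt t + ?K k0 t"
      by (rule integral_unique)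
  next
    fix t assume t: "t \<in> {e<..}"
    have "((\<lambda>t. 4 / 3 * t * sqrt t) has_real_derivative 2 * sqrt t) (at t)"
      using t e by (auto intro!: derivative_eq_intros simp: field_simps)
    moreover have "(?K k0 has_real_derivative ?K k1 t) (at t)"
      using t by (intro kernel_integral_derivative[OF cont_g k0 cont_k1]) auto
    ultimately show "((\<lambda>t. 4 / 3 * t * sqrt t + ?K k0 t) has_real_derivative
        2 * sqrt t + ?K k1 t) (at t)"
      by (rule DERIV_add)
    have "((\<lambda>t. 2 * sqrt t) has_real_derivative 1 / sqrt t) (at t)"
      using t e by (auto intro!: derivative_eq_intros simp: field_simps)
    moreover have "(?K k1 has_real_derivative d2 t) (at t)"
      unfolding d2_def using t by (intro kernel_integral_derivative[OF cont_g k1 cont_k2]) auto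
    ultimately show "((\<lambda>t. 2 * sqrt t + ?K k1 t) has_real_derivative 1 / sqrt t + d2 t) (at t)"
      by (rule DERIV_add)
  qed
  have outer_le: "\<bar>d2 s\<bar> \<le> 312 * e * (1 / sqrt (s - e))" if s: "s > e" for s
  proof -
    \<comment> \<open>Bounding \<open>g\<close> by a constant would leave a singularity of order
      \<open>-3/2\<close> at \<open>s = e\<close>. Instead
      \<open>\<bar>g u\<bar> \<le> 48 * e * (s - u)\<close> is used: by \<open>k2_k1\<close> the
      integrand is at most \<open>- 72 * e * k1 (s - u)\<close>, with antiderivative
      \<open>?F\<close>.\<close>
    let ?F = "\<lambda>u. 72 * e * k0 (s - u)"
    have "norm (d2 s) \<le> integral {0..e} (\<lambda>u. 36 * e * (- 2 * k1 (s - u)))"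
      unfolding d2_def
    proof (rule integral_norm_bound_integral)
      show "(\<lambda>u. g u * k2 (s - u)) integrable_on {0..e}"
        using s by (intro integrable_continuous_real continuous_intros cont_g
            continuous_on_compose2[OF cont_k2]) auto
      show "(\<lambda>u. 36 * e * (- 2 * k1 (s - u))) integrable_on {0..e}"
        using s by (intro integrable_continuous_real continuous_intros
            continuous_on_compose2[OF cont_k1]) auto
      fix u assume u: "u \<in> {0..e}"
      have "\<bar>g u\<bar> \<le> 48 * e * (e - u)"
        using lip[of e u] u g_ends by auto
      also have "\<dots> \<le> 48 * e * (s - u)" using e s by (intro mult_left_mono) auto
      finally have "\<bar>g u\<bar> * k2 (s - u) \<le> 48 * e * (s - u) * k2 (s - u)"
        using u s by (intro mult_right_mono) (auto simp: k2_def)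
      also have "\<dots> = 36 * e * (- 2 * k1 (s - u))"
        using k2_k1[of "s - u"] u s by (simp add: mult.assoc)
      finally show "norm (g u * k2 (s - u)) \<le> 36 * e * (- 2 * k1 (s - u))"
        using u s by (simp add: abs_mult k2_def)
    qed
    also have "((\<lambda>u. 36 * e * (- 2 * k1 (s - u))) has_integral ?F e - ?F 0) {0..e}"
    proof (rule fundamental_theorem_of_calculus)
      show "(?F has_vector_derivative 36 * e * (- 2 * k1 (s - u))) (at u within {0..e})"
        if "u \<in> {0..e}" for u
      proof -
        have "((\<lambda>u. k0 (s - u)) has_real_derivative k1 (s - u) * (- 1)) (at u within {0..e})"
          using that s by (intro DERIV_chain2[OF k0]) (auto intro!: derivative_eq_intros)
        from DERIV_cmult[OF this, of "72 * e"] show ?thesis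
          by (simp add: has_real_derivative_iff_has_vector_derivative mult_ac)
      qed
    qed (use e in simp)
    then have "integral {0..e} (\<lambda>u. 36 * e * (- 2 * k1 (s - u))) = ?F e - ?F 0"
      by (rule integral_unique)
    also have "\<dots> \<le> 312 * e * k0 (s - e)"
    proof -
      \<comment> \<open>The constant 72 is enlarged to 312 so that both regions share one
        constant.\<close>
      have "0 \<le> 72 * e * k0 (s - 0)" "72 * e * k0 (s - e) \<le> 312 * e * k0 (s - e)"
        using s e by (auto simp: k0_def intro!: mult_right_mono divide_right_mono)
      then show ?thesis by linarith
    qed
    finally show ?thesis by (simp add: k0_def)
  qed
  have cont_d2: "continuous_on {e<..} d2"
    unfolding d2_def by (rule continuous_on_kernel_integral[OF cont_g cont_k2])
  \<comment> \<open>Measurability follows from continuity of each branch on its open interval. At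
    \<open>s = e\<close> the value is 0, and the formula for \<open>\<phi>'\<close> excludes this
    point.\<close>
  define d where "d s = indicator {0<..<e} s *\<^sub>R d1 s + indicator {e<..} s *\<^sub>R d2 s" for s
  show ?thesis
  proof (rule that[of d], unfold e_def[symmetric])
    show "d \<in> borel_measurable borel"
      unfolding d_def using cont_d1 cont_d2
      by (intro borel_measurable_add borel_measurable_continuous_on_indicator) auto
    show "vector_derivative (phi \<Gamma>) (at s within {0..1}) = (1 / sqrt s + d s) / pi\<^sup>2"
      if "s \<in> {0<..1} - {e}" for s
      using that inner[of s] outer[of s] by (auto simp: d_def indicator_def)
    show "\<bar>d s\<bar> \<le> 312 * e * (1 / sqrt s)" if "s \<in> {0<..<e}" for s
      using inner_le[OF that] that by (auto simp: d_def)
    show "\<bar>d s\<bar> \<le> 312 * e * (1 / sqrt (s - e))" if "s > e" for s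
      using outer_le[OF that] that by (auto simp: d_def)
  qed
qed

subsection \<open>Integrals over phase space\<close>

text \<open>For \<open>D > 0\<close> an antiderivative is \<open>arcsin ((t - b) / sqrt D)\<close>,
  with total increase \<open>pi\<close>. That the bound depends on neither \<open>b\<close> nor
  \<open>D\<close> makes the phase space estimates uniform.\<close>

lemma nn_integral_arcsine_density_le:
  fixes b D :: real
  shows "(\<integral>\<^sup>+t. ennreal (if D - (t - b)\<^sup>2 > 0 then 1 / sqrt (D - (t - b)\<^sup>2) else 0) \<partial>lborel) \<le> ennreal pi"
proof (cases "D > 0")
  case False
  then have "\<not> D - (t - b)\<^sup>2 > 0" for t
    by (smt (verit) zero_le_power2)
  then show ?thesis by simp
next
  case True
  define r where "r = sqrt D"
  have r: "r > 0" "D = r\<^sup>2" using True by (simp_all add: r_def)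
  let ?f = "\<lambda>t. 1 / sqrt (D - (t - b)\<^sup>2)"
  let ?F = "\<lambda>t. arcsin ((t - b) / r)"
  have "(?f has_integral ?F (b + r) - ?F (b - r)) {b - r..b + r}"
  proof (rule fundamental_theorem_of_calculus_interior)
    show "continuous_on {b - r..b + r} ?F"
      using r by (intro continuous_intros) (auto simp: field_simps)
    fix t assume t: "t \<in> {b - r<..<b + r}"
    have "- 1 < (t - b) / r" "(t - b) / r < 1" using t r by (auto simp: field_simps)
    then have "(?F has_real_derivative inverse (sqrt (1 - ((t - b) / r)\<^sup>2)) * (1 / r)) (at t)"
      using r by (intro DERIV_chain2[OF DERIV_arcsin]) (auto intro!: derivative_eq_intros)
    also have "inverse (sqrt (1 - ((t - b) / r)\<^sup>2)) * (1 / r) = ?f t"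
    proof -
      have "D - (t - b)\<^sup>2 = r\<^sup>2 * (1 - ((t - b) / r)\<^sup>2)"
        using r by (simp add: field_simps power2_eq_square)
      then have "sqrt (D - (t - b)\<^sup>2) = r * sqrt (1 - ((t - b) / r)\<^sup>2)"
        using r by (simp add: real_sqrt_mult)
      then show ?thesis by (simp add: field_simps)
    qed
    finally show "(?F has_vector_derivative ?f t) (at t)"
      by (simp add: has_real_derivative_iff_has_vector_derivative)
  qed (use r in simp)
  then have int: "(?f has_integral pi) {b - r..b + r}" using r by simp
  have nonneg: "0 \<le> ?f t" if "t \<in> {b - r..b + r}" for t
  proof -
    have "\<bar>t - b\<bar> \<le> \<bar>r\<bar>" using that by auto
    then show ?thesis unfolding r(2) abs_le_square_iff by simp
  qed
  have "(\<integral>\<^sup>+t. ennreal (if D - (t - b)\<^sup>2 > 0 then ?f t else 0) \<partial>lborel)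
      \<le> (\<integral>\<^sup>+t. ennreal (indicator {b - r..b + r} t * ?f t) \<partial>lborel)"
  proof (intro nn_integral_mono ennreal_leI)
    fix t :: real
    have "t \<in> {b - r..b + r}" if "D - (t - b)\<^sup>2 > 0"
    proof -
      have "(t - b)\<^sup>2 \<le> r\<^sup>2" using that r by simp
      then have "\<bar>t - b\<bar> \<le> r" using r(1) by (metis abs_le_square_iff abs_of_pos)
      then show ?thesis by auto
    qed
    then show "(if D - (t - b)\<^sup>2 > 0 then ?f t else 0) \<le> indicator {b - r..b + r} t * ?f t"
      using nonneg[of t] by (auto simp: indicator_def)
  qed
  also have "\<dots> = ennreal pi"
    by (rule nn_integral_has_integral_lebesgue[OF nonneg int])
  finally show ?thesis .
qed

text \<open>By translation invariance, \<open>f\<close> may be replaced by its average over the segment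
  \<open>{v + t e | 0 \<le> t \<le> 1}\<close>.\<close>

lemma nn_integral_le_line_bound:
  fixes f :: "'a::euclidean_space \<Rightarrow> ennreal"
  assumes [measurable]: "f \<in> borel_measurable borel"
    and supp: "\<And>v. norm v \<ge> 1 \<Longrightarrow> f v = 0" and u: "norm u = 1"
    and line: "\<And>v. (\<integral>\<^sup>+t. f (v + t *\<^sub>R u) \<partial>lborel) \<le> C"
  shows "(\<integral>\<^sup>+v. f v \<partial>lborel) \<le> C * emeasure lborel (cball (0::'a) 2)"
proof -
  have shift: "(\<integral>\<^sup>+v. f (v + t *\<^sub>R u) \<partial>lborel) = (\<integral>\<^sup>+v. f v \<partial>lborel)" for t
  proof -
    have "(\<integral>\<^sup>+v. f v \<partial>lborel) = (\<integral>\<^sup>+v. f v \<partial>distr lborel borel ((+) (t *\<^sub>R u)))"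
      by (simp add: lborel_distr_plus)
    also have "\<dots> = (\<integral>\<^sup>+v. f (t *\<^sub>R u + v) \<partial>lborel)"
      by (subst nn_integral_distr) auto
    finally show ?thesis by (simp add: add.commute)
  qed
  have "(\<integral>\<^sup>+v. f v \<partial>lborel) = (\<integral>\<^sup>+t. indicator {0..1::real} t * (\<integral>\<^sup>+v. f v \<partial>lborel) \<partial>lborel)"
    by (simp add: nn_integral_multc)
  also have "\<dots> = (\<integral>\<^sup>+t. (\<integral>\<^sup>+v. indicator {0..1::real} t * f (v + t *\<^sub>R u) \<partial>lborel) \<partial>lborel)"
    by (simp add: nn_integral_cmult shift)
  also have "\<dots> = (\<integral>\<^sup>+v. (\<integral>\<^sup>+t. indicator {0..1::real} t * f (v + t *\<^sub>R u) \<partial>lborel) \<partial>lborel)"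
    by (rule lborel_pair.Fubini') measurable
  also have "\<dots> \<le> (\<integral>\<^sup>+v. C * indicator (cball (0::'a) 2) v \<partial>lborel)"
  proof (rule nn_integral_mono)
    fix v :: 'a
    show "(\<integral>\<^sup>+t. indicator {0..1::real} t * f (v + t *\<^sub>R u) \<partial>lborel) \<le> C * indicator (cball 0 2) v"
    proof (cases "v \<in> cball 0 2")
      case True
      have "(\<integral>\<^sup>+t. indicator {0..1::real} t * f (v + t *\<^sub>R u) \<partial>lborel) \<le> (\<integral>\<^sup>+t. f (v + t *\<^sub>R u) \<partial>lborel)"
        by (intro nn_integral_mono) (auto simp: indicator_def)
      also note line
      finally show ?thesis using True by simp
    next
      case False
      \<comment> \<open>A segment of length 1 starting at distance more than 2 from the origin
        misses the unit ball.\<close>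
      have "f (v + t *\<^sub>R u) = 0" if "t \<in> {0..1}" for t
      proof (rule supp)
        have "norm (t *\<^sub>R u) \<le> 1" using that u by simp
        then show "1 \<le> norm (v + t *\<^sub>R u)"
          using False norm_diff_ineq[of v "t *\<^sub>R u"] by simp
      qed
      then have "(\<integral>\<^sup>+t. indicator {0..1::real} t * f (v + t *\<^sub>R u) \<partial>lborel) = (\<integral>\<^sup>+(t::real). 0 \<partial>lborel)"
        by (intro nn_integral_cong) (auto simp: indicator_def)
      then show ?thesis by simp
    qed
  qed
  also have "\<dots> = C * emeasure lborel (cball (0::'a) 2)"
    by (simp add: nn_integral_cmult_indicator)
  finally show ?thesis .
qed

section \<open>The function \<open>s_xv\<close> and its inverse square root kernels\<close>

text \<open>Lagrange's identity for the norm of the cross product. The product form gives access to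
  the signs of \<open>1 - (norm x)\<^sup>2\<close> and \<open>1 - (norm v)\<^sup>2\<close>.\<close>

lemma s_xv_alt: "s_xv x v = (1 - (norm x)\<^sup>2) * (1 - (norm v)\<^sup>2) - (x \<bullet> v)\<^sup>2"
  by (simp add: s_xv_def norm_cross algebra_simps)

text \<open>A shift of \<open>v\<close> parallel to \<open>x\<close> preserves the cross product, so
  only \<open>(norm v)\<^sup>2\<close> changes; then complete the square. The form of the second
  hypothesis admits \<open>x = 0\<close> with any unit vector \<open>u\<close>.\<close>

lemma s_xv_shift_radial:
  assumes u: "norm u = 1" and x: "x = norm x *\<^sub>R u"
  shows "s_xv x (v + t *\<^sub>R u) = s_xv x v + (v \<bullet> u)\<^sup>2 - (t + v \<bullet> u)\<^sup>2"
proof -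
  have "(norm (v + t *\<^sub>R u))\<^sup>2 = (norm v)\<^sup>2 + 2 * t * (v \<bullet> u) + t\<^sup>2"
    using u unfolding power2_norm_eq_inner
    by (simp add: inner_simps norm_eq_1 inner_commute power2_eq_square algebra_simps)
  moreover have "x \<bullet> w = norm x * (w \<bullet> u)" for w
    by (subst x) (simp add: inner_commute)
  then have "x \<bullet> v = norm x * (v \<bullet> u)" "x \<bullet> (v + t *\<^sub>R u) = norm x * (v \<bullet> u + t)"
    using u by (simp_all add: inner_add_left norm_eq_1)
  ultimately have "s_xv x (v + t *\<^sub>R u) - s_xv x v =
      (1 - (norm x)\<^sup>2) * (1 - ((norm v)\<^sup>2 + 2 * t * (v \<bullet> u) + t\<^sup>2)) - (norm x * (v \<bullet> u + t))\<^sup>2 -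
      ((1 - (norm x)\<^sup>2) * (1 - (norm v)\<^sup>2) - (norm x * (v \<bullet> u))\<^sup>2)"
    by (simp only: s_xv_alt)
  also have "\<dots> = (v \<bullet> u)\<^sup>2 - (t + v \<bullet> u)\<^sup>2"
    by (simp add: power2_eq_square algebra_simps)
  finally show ?thesis by simp
qed

lemma borel_measurable_s_xv [measurable]:
  "(\<lambda>p. s_xv (fst p) (snd p)) \<in> borel_measurable borel"
  unfolding s_xv_alt by (intro borel_measurable_continuous_onI continuous_intros)

text \<open>The dominating function, used with \<open>\<delta> = 0\<close> and
  \<open>\<delta> = 1 - \<Gamma>\<close>. The cutoffs are essential: \<open>s_xv\<close> is also
  positive for large orthogonal \<open>x\<close> and \<open>v\<close>, where both factors of its
  product form are negative.\<close>

definition sqrt_kernel :: "real \<Rightarrow> (real^3) \<times> (real^3) \<Rightarrow> real" where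
  "sqrt_kernel \<delta> p = (if norm (fst p) < 1 \<and> norm (snd p) < 1 \<and> s_xv (fst p) (snd p) > \<delta>
     then 1 / sqrt (s_xv (fst p) (snd p) - \<delta>) else 0)"

lemma sqrt_kernel_nonneg: "0 \<le> sqrt_kernel \<delta> p"
  by (simp add: sqrt_kernel_def)

lemma borel_measurable_sqrt_kernel [measurable]: "sqrt_kernel \<delta> \<in> borel_measurable borel"
proof -
  have [measurable]: "(\<lambda>p::(real^3) \<times> (real^3). norm (fst p)) \<in> borel_measurable borel"
      "(\<lambda>p::(real^3) \<times> (real^3). norm (snd p)) \<in> borel_measurable borel"
    by (intro borel_measurable_continuous_onI continuous_intros)+
  show ?thesis unfolding sqrt_kernel_def[abs_def] by measurable
qed

text \<open>The factors come from the arcsine integral, the averaging over segments in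
  \<open>v\<close>, and the range of \<open>x\<close>.\<close>

definition kernel_bound :: real where
  "kernel_bound = pi * measure lborel (cball (0::real^3) 2) * measure lborel (cball (0::real^3) 1)"

lemma emeasure_lborel_cball_eq: "emeasure lborel (cball (0::real^3) r) = ennreal (measure lborel (cball (0::real^3) r))"
  by (rule emeasure_eq_ennreal_measure) (use emeasure_lborel_cball_finite in \<open>auto simp: less_top\<close>)

lemma nn_integral_sqrt_kernel_fibre_le:
  "(\<integral>\<^sup>+v. ennreal (sqrt_kernel \<delta> (x, v)) \<partial>lborel) \<le>
    ennreal (pi * measure lborel (cball (0::real^3) 2)) * indicator (cball 0 1) x"
proof (cases "norm x < 1")
  case False
  then show ?thesis by (simp add: sqrt_kernel_def)
next
  case True
  obtain u :: "real^3" where u: "norm u = 1" "x = norm x *\<^sub>R u"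
  proof (cases "x = 0")
    case True
    then show thesis using that[of "axis 1 1"] by simp
  next
    case False
    then show thesis using that[of "x /\<^sub>R norm x"] by simp
  qed
  have "(\<integral>\<^sup>+v. ennreal (sqrt_kernel \<delta> (x, v)) \<partial>lborel) \<le> ennreal pi * emeasure lborel (cball (0::real^3) 2)"
  proof (rule nn_integral_le_line_bound[OF _ _ u(1)])
    have "(\<lambda>v. (x, v)) \<in> borel_measurable borel"
      by (intro borel_measurable_continuous_onI continuous_intros)
    from measurable_compose[OF this borel_measurable_sqrt_kernel]
    show "(\<lambda>v. ennreal (sqrt_kernel \<delta> (x, v))) \<in> borel_measurable borel"
      by (rule measurable_compose[OF _ measurable_ennreal])
    show "ennreal (sqrt_kernel \<delta> (x, v)) = 0" if "1 \<le> norm v" for v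
      using that by (simp add: sqrt_kernel_def)
    fix v :: "real^3"
    let ?D = "s_xv x v + (v \<bullet> u)\<^sup>2 - \<delta>" and ?b = "- (v \<bullet> u)"
    have "(\<integral>\<^sup>+t. ennreal (sqrt_kernel \<delta> (x, v + t *\<^sub>R u)) \<partial>lborel) \<le>
        (\<integral>\<^sup>+t. ennreal (if ?D - (t - ?b)\<^sup>2 > 0 then 1 / sqrt (?D - (t - ?b)\<^sup>2) else 0) \<partial>lborel)"
    proof (intro nn_integral_mono ennreal_leI)
      fix t :: real
      \<comment> \<open>Along the line the kernel is an arcsine density centred at
        \<open>?b\<close>; dropping the norm cutoffs can only enlarge it.\<close>
      have "s_xv x (v + t *\<^sub>R u) - \<delta> = ?D - (t - ?b)\<^sup>2"
        using s_xv_shift_radial[OF u] by simp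
      moreover have "sqrt_kernel \<delta> (x, v + t *\<^sub>R u) \<le> (if s_xv x (v + t *\<^sub>R u) - \<delta> > 0
          then 1 / sqrt (s_xv x (v + t *\<^sub>R u) - \<delta>) else 0)"
        by (simp add: sqrt_kernel_def)
      ultimately show "sqrt_kernel \<delta> (x, v + t *\<^sub>R u) \<le> (if ?D - (t - ?b)\<^sup>2 > 0 then 1 / sqrt (?D - (t - ?b)\<^sup>2) else 0)"
        by (simp only:)
    qed
    also note nn_integral_arcsine_density_le
    finally show "(\<integral>\<^sup>+t. ennreal (sqrt_kernel \<delta> (x, v + t *\<^sub>R u)) \<partial>lborel) \<le> ennreal pi" .
  qed
  then show ?thesis using True by (simp add: emeasure_lborel_cball_eq ennreal_mult)
qed

lemma nn_integral_sqrt_kernel_le: "(\<integral>\<^sup>+p. ennreal (sqrt_kernel \<delta> p) \<partial>lborel) \<le> ennreal kernel_bound"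
proof -
  have meas: "(\<lambda>p. ennreal (sqrt_kernel \<delta> p)) \<in> borel_measurable (lborel \<Otimes>\<^sub>M lborel)"
    by (simp add: lborel_prod)
  have "(\<integral>\<^sup>+p. ennreal (sqrt_kernel \<delta> p) \<partial>lborel) = (\<integral>\<^sup>+p. ennreal (sqrt_kernel \<delta> p) \<partial>(lborel \<Otimes>\<^sub>M lborel))"
    by (simp add: lborel_prod)
  also have "\<dots> = (\<integral>\<^sup>+x. \<integral>\<^sup>+v. ennreal (sqrt_kernel \<delta> (x, v)) \<partial>lborel \<partial>lborel)"
    by (rule lborel.nn_integral_fst[OF meas, symmetric])
  also have "\<dots> \<le> (\<integral>\<^sup>+x. ennreal (pi * measure lborel (cball (0::real^3) 2)) * indicator (cball (0::real^3) 1) x \<partial>lborel)"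
    by (intro nn_integral_mono nn_integral_sqrt_kernel_fibre_le)
  also have "\<dots> = ennreal kernel_bound"
    unfolding kernel_bound_def
    by (subst nn_integral_cmult_indicator) (simp_all add: emeasure_lborel_cball_eq ennreal_mult)
  finally show ?thesis .
qed

lemma integrable_sqrt_kernel: "integrable lborel (sqrt_kernel \<delta>)"
  using nn_integral_sqrt_kernel_le[of \<delta>]
  by (intro integrableI_nonneg) (auto simp: sqrt_kernel_nonneg intro: le_less_trans)

lemma integral_sqrt_kernel_le: "(\<integral>p. sqrt_kernel \<delta> p \<partial>lborel) \<le> kernel_bound"
proof -
  have "ennreal (\<integral>p. sqrt_kernel \<delta> p \<partial>lborel) \<le> ennreal kernel_bound"
    using nn_integral_sqrt_kernel_le[of \<delta>]
    by (simp add: nn_integral_eq_integral[OF integrable_sqrt_kernel] sqrt_kernel_nonneg)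
  then show ?thesis by (simp add: kernel_bound_def)
qed

subsection \<open>Comparison with the Kurth density\<close>

text \<open>Positivity of \<open>s_xv\<close> forces \<open>1 - (norm x)\<^sup>2\<close> and
  \<open>1 - (norm v)\<^sup>2\<close> to have the same sign. Were both negative, then \<open>(norm
  (cross3 x v))\<^sup>2 > (norm x)\<^sup>2 + (norm v)\<^sup>2 - 1 > 1\<close>.\<close>

lemma Kurth_support:
  assumes s: "s_xv x v > 0" and L: "norm (cross3 x v) < 1"
  shows "norm x < 1" "norm v < 1" "s_xv x v \<le> 1"
proof -
  let ?a = "(norm x)\<^sup>2" and ?b = "(norm v)\<^sup>2"
  have pos: "(1 - ?a) * (1 - ?b) > 0"
    using s zero_le_power2[of "x \<bullet> v"] unfolding s_xv_alt by linarith
  have L2: "(norm (cross3 x v))\<^sup>2 < 1"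
    using L by (simp add: power_less_one_iff abs_square_less_1)
  have ab: "?a < 1 \<and> ?b < 1"
  proof (rule ccontr)
    assume "\<not> ?thesis"
    with pos have "1 < ?a" "1 < ?b" by (auto simp: zero_less_mult_iff)
    then have "1 < (norm (cross3 x v))\<^sup>2"
      using s unfolding s_xv_def by linarith
    with L2 show False by simp
  qed
  then show "norm x < 1" "norm v < 1" by (auto simp: abs_square_less_1)
  have "(1 - ?a) * (1 - ?b) \<le> 1 * 1" using ab by (intro mult_mono) auto
  then show "s_xv x v \<le> 1"
    using zero_le_power2[of "x \<bullet> v"] unfolding s_xv_alt by linarith
qed

lemma borel_measurable_norm_cross3 [measurable]:
  "(\<lambda>p. norm (cross3 (fst p) (snd p))) \<in> borel_measurable borel"
  by (intro borel_measurable_continuous_onI continuous_intros continuous_on_cross)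

lemma f_Kurth_alt:
  "f_Kurth p = (if s_xv (fst p) (snd p) > 0 \<and> norm (cross3 (fst p) (snd p)) < 1
     then 3 / (4 * pi ^ 3) * (1 / sqrt (s_xv (fst p) (snd p))) else 0)"
proof -
  have "1 - (norm x)\<^sup>2 - (norm v)\<^sup>2 + (norm (cross3 x v))\<^sup>2 = s_xv x v" for x v :: "real^3"
    by (simp add: s_xv_def)
  then show ?thesis by (simp add: f_Kurth_def case_prod_unfold)
qed

lemma f_Kurth_nonneg: "0 \<le> f_Kurth p"
  by (simp add: f_Kurth_alt)

lemma f_Kurth_le_sqrt_kernel: "f_Kurth p \<le> 3 / (4 * pi ^ 3) * sqrt_kernel 0 p"
  using Kurth_support[of "fst p" "snd p"] by (auto simp: f_Kurth_alt sqrt_kernel_def mult.commute)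

lemma borel_measurable_f_Kurth [measurable]: "f_Kurth \<in> borel_measurable borel"
  unfolding f_Kurth_alt[abs_def] by measurable

lemma integrable_f_Kurth: "integrable lborel f_Kurth"
proof (rule Bochner_Integration.integrable_bound)
  show "integrable lborel (\<lambda>p. 3 / (4 * pi ^ 3) * sqrt_kernel 0 p)"
    by (intro integrable_mult_right integrable_sqrt_kernel)
  show "AE p in lborel. norm (f_Kurth p) \<le> norm (3 / (4 * pi ^ 3) * sqrt_kernel 0 p)"
    using f_Kurth_le_sqrt_kernel by (auto simp: f_Kurth_nonneg sqrt_kernel_nonneg)
qed simp

text \<open>On this set \<open>f_Gamma\<close> is 0 by definition, while the Kurth density may be
  positive. Including the level set of \<open>s_xv\<close> here lets dominated convergence handle
  it, with no proof that it is null.\<close>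

definition defect_set :: "real \<Rightarrow> ((real^3) \<times> (real^3)) set" where
  "defect_set \<Gamma> = {p. (norm (cross3 (fst p) (snd p)))\<^sup>2 > \<Gamma> \<or> s_xv (fst p) (snd p) = 1 - \<Gamma>}"

lemma borel_measurable_defect_set [measurable]: "defect_set \<Gamma> \<in> sets borel"
  unfolding defect_set_def by measurable

text \<open>Off the defect set and for positive \<open>s_xv\<close>, the profile
  \<open>1 / sqrt s\<close> in \<open>\<phi>'\<close> reproduces the Kurth density, so the
  difference is a multiple of \<open>d\<close>. The two kernels dominate it below and above
  \<open>s = 1 - \<Gamma>\<close>; their sum covers both cases.\<close>

lemma f_Gamma_near_Kurth:
  assumes \<Gamma>: "\<Gamma> \<in> {1 - 1 / 2 ^ 12..<1}"
  shows "f_Gamma \<Gamma> \<in> borel_measurable borel"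
    and "\<bar>f_Gamma \<Gamma> p - f_Kurth p\<bar> \<le>
      312 * (1 - \<Gamma>) * (sqrt_kernel 0 p + sqrt_kernel (1 - \<Gamma>) p) + indicator (defect_set \<Gamma>) p * f_Kurth p"
proof -
  obtain d :: "real \<Rightarrow> real"
    where d [measurable]: "d \<in> borel_measurable borel"
    and phi': "\<And>s. s \<in> {0<..1} - {1 - \<Gamma>} \<Longrightarrow>
      vector_derivative (phi \<Gamma>) (at s within {0..1}) = (1 / sqrt s + d s) / pi\<^sup>2"
    and inner: "\<And>s. s \<in> {0<..<1 - \<Gamma>} \<Longrightarrow> \<bar>d s\<bar> \<le> 312 * (1 - \<Gamma>) * (1 / sqrt s)"
    and outer: "\<And>s. s > 1 - \<Gamma> \<Longrightarrow> \<bar>d s\<bar> \<le> 312 * (1 - \<Gamma>) * (1 / sqrt (s - (1 - \<Gamma>)))"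
    using phi_second_derivative[OF \<Gamma>] by metis
  let ?s = "\<lambda>p. s_xv (fst p) (snd p)" and ?L = "\<lambda>p. norm (cross3 (fst p) (snd p))"
  let ?c = "3 / (4 * pi ^ 3)"
  have f: "f_Gamma \<Gamma> p = (if (?L p)\<^sup>2 \<le> \<Gamma> \<and> 0 < ?s p \<and> ?s p \<le> 1 \<and> ?s p \<noteq> 1 - \<Gamma>
      then ?c * (1 / sqrt (?s p) + d (?s p)) else 0)" for p
    using phi'[of "?s p"] by (auto simp: f_Gamma_def case_prod_unfold power3_eq_cube power2_eq_square)
  show "f_Gamma \<Gamma> \<in> borel_measurable borel"
    unfolding f[abs_def] by measurable
  \<comment> \<open>The prefactor \<open>3 / (4 * pi)\<close> of \<open>f_Gamma\<close> times
    \<open>1 / pi\<^sup>2\<close> from \<open>\<phi>'\<close>.\<close>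
  have c: "0 \<le> ?c" "?c \<le> 1"
  proof -
    have "3 ^ 3 \<le> pi ^ 3" by (intro power_mono) (use pi_gt3 in auto)
    then show "0 \<le> ?c" "?c \<le> 1" by (auto simp: divide_le_eq)
  qed
  have e: "0 < 1 - \<Gamma>" using \<Gamma> by simp
  show "\<bar>f_Gamma \<Gamma> p - f_Kurth p\<bar> \<le>
      312 * (1 - \<Gamma>) * (sqrt_kernel 0 p + sqrt_kernel (1 - \<Gamma>) p) + indicator (defect_set \<Gamma>) p * f_Kurth p"
  proof (cases "p \<in> defect_set \<Gamma>")
    case True
    then have "f_Gamma \<Gamma> p = 0" by (auto simp: f defect_set_def)
    moreover have "0 \<le> 312 * (1 - \<Gamma>) * (sqrt_kernel 0 p + sqrt_kernel (1 - \<Gamma>) p)"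
      using e by (intro mult_nonneg_nonneg add_nonneg_nonneg sqrt_kernel_nonneg) auto
    ultimately show ?thesis using True f_Kurth_nonneg[of p] by simp
  next
    case False
    then have L: "(?L p)\<^sup>2 \<le> \<Gamma>" and ne: "?s p \<noteq> 1 - \<Gamma>" by (auto simp: defect_set_def)
    then have L1: "?L p < 1" using \<Gamma> abs_square_less_1[of "?L p"] by simp
    show ?thesis
    proof (cases "?s p > 0")
      case pos: True
      note supp = Kurth_support[OF pos L1]
      have "f_Gamma \<Gamma> p - f_Kurth p = ?c * d (?s p)"
        using L ne L1 pos supp by (simp add: f f_Kurth_alt distrib_left)
      then have "\<bar>f_Gamma \<Gamma> p - f_Kurth p\<bar> = ?c * \<bar>d (?s p)\<bar>"
        using c by (simp add: abs_mult)
      also have "\<dots> \<le> 1 * \<bar>d (?s p)\<bar>" using c by (intro mult_right_mono) auto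
      also have "\<dots> \<le> 312 * (1 - \<Gamma>) * (sqrt_kernel 0 p + sqrt_kernel (1 - \<Gamma>) p)"
      proof (cases "?s p < 1 - \<Gamma>")
        case True
        then have "\<bar>d (?s p)\<bar> \<le> 312 * (1 - \<Gamma>) * sqrt_kernel 0 p"
          using inner[of "?s p"] pos supp by (simp add: sqrt_kernel_def)
        also have "\<dots> \<le> 312 * (1 - \<Gamma>) * (sqrt_kernel 0 p + sqrt_kernel (1 - \<Gamma>) p)"
          using e sqrt_kernel_nonneg by (intro mult_left_mono) auto
        finally show ?thesis by simp
      next
        case False
        then have "\<bar>d (?s p)\<bar> \<le> 312 * (1 - \<Gamma>) * sqrt_kernel (1 - \<Gamma>) p"
          using outer[of "?s p"] ne supp by (simp add: sqrt_kernel_def)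
        also have "\<dots> \<le> 312 * (1 - \<Gamma>) * (sqrt_kernel 0 p + sqrt_kernel (1 - \<Gamma>) p)"
          using e sqrt_kernel_nonneg by (intro mult_left_mono) auto
        finally show ?thesis by simp
      qed
      finally show ?thesis using False by simp
    next
      case nonpos: False
      have "0 \<le> 312 * (1 - \<Gamma>) * (sqrt_kernel 0 p + sqrt_kernel (1 - \<Gamma>) p)"
        using e by (intro mult_nonneg_nonneg add_nonneg_nonneg sqrt_kernel_nonneg) auto
      then show ?thesis using nonpos False by (simp add: f f_Kurth_alt)
    qed
  qed
qed

section \<open>Passage to the limit\<close>

lemma integrable_f_Kurth_defect: "integrable lborel (\<lambda>p. indicator (defect_set \<Gamma>) p * f_Kurth p)"
  using integrable_real_mult_indicator[OF _ integrable_f_Kurth, of "defect_set \<Gamma>"]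
  by (simp add: mult.commute)

lemma integrable_majorant:
  "integrable lborel (\<lambda>p. c * (sqrt_kernel 0 p + sqrt_kernel (1 - \<Gamma>) p) + indicator (defect_set \<Gamma>) p * f_Kurth p)"
  by (intro Bochner_Integration.integrable_add integrable_mult_right integrable_sqrt_kernel
      integrable_f_Kurth_defect)

lemma integrable_diff_f_Gamma:
  assumes "\<Gamma> \<in> {1 - 1 / 2 ^ 12..<1}"
  shows "integrable lborel (\<lambda>p. f_Gamma \<Gamma> p - f_Kurth p)"
proof (rule Bochner_Integration.integrable_bound[OF integrable_majorant[of "312 * (1 - \<Gamma>)" \<Gamma>]])
  show "(\<lambda>p. f_Gamma \<Gamma> p - f_Kurth p) \<in> borel_measurable lborel"
    using f_Gamma_near_Kurth(1)[OF assms] by simp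
  show "AE p in lborel. norm (f_Gamma \<Gamma> p - f_Kurth p) \<le>
      norm (312 * (1 - \<Gamma>) * (sqrt_kernel 0 p + sqrt_kernel (1 - \<Gamma>) p) + indicator (defect_set \<Gamma>) p * f_Kurth p)"
    using f_Gamma_near_Kurth(2)[OF assms] by (intro AE_I2) (metis abs_ge_self order_trans real_norm_def)
qed

text \<open>Integrates the pointwise bound. Both kernels have integral at most
  \<open>kernel_bound\<close>, whence \<open>624 = 2 * 312\<close>.\<close>

lemma integral_diff_f_Gamma_le:
  assumes \<Gamma>: "\<Gamma> \<in> {1 - 1 / 2 ^ 12..<1}"
  shows "(\<integral>p. \<bar>f_Gamma \<Gamma> p - f_Kurth p\<bar> \<partial>lborel) \<le>
    624 * kernel_bound * (1 - \<Gamma>) + (\<integral>p. indicator (defect_set \<Gamma>) p * f_Kurth p \<partial>lborel)"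
proof -
  have "(\<integral>p. \<bar>f_Gamma \<Gamma> p - f_Kurth p\<bar> \<partial>lborel) \<le>
      (\<integral>p. 312 * (1 - \<Gamma>) * (sqrt_kernel 0 p + sqrt_kernel (1 - \<Gamma>) p) + indicator (defect_set \<Gamma>) p * f_Kurth p \<partial>lborel)"
    by (intro integral_mono integrable_abs integrable_diff_f_Gamma integrable_majorant
        f_Gamma_near_Kurth(2) \<Gamma>)
  also have "\<dots> = 312 * (1 - \<Gamma>) * ((\<integral>p. sqrt_kernel 0 p \<partial>lborel) + (\<integral>p. sqrt_kernel (1 - \<Gamma>) p \<partial>lborel)) +
      (\<integral>p. indicator (defect_set \<Gamma>) p * f_Kurth p \<partial>lborel)"
    using integrable_sqrt_kernel integrable_f_Kurth_defect by simp
  also have "\<dots> \<le> 312 * (1 - \<Gamma>) * (kernel_bound + kernel_bound) +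
      (\<integral>p. indicator (defect_set \<Gamma>) p * f_Kurth p \<partial>lborel)"
    using \<Gamma> by (intro add_mono mult_left_mono integral_sqrt_kernel_le) auto
  finally show ?thesis by (simp add: algebra_simps)
qed

text \<open>Dominated convergence with majorant \<open>f_Kurth\<close>: a point with nonzero Kurth
  density has \<open>s_xv > 0\<close> and \<open>norm (cross3 x v) < 1\<close>, both strict, so it
  leaves the defect sets once \<open>X n\<close> is close to 1.\<close>

lemma integral_f_Kurth_defect_tendsto:
  assumes X: "X \<longlonglongrightarrow> 1" "\<And>n. X n < 1"
  shows "(\<lambda>n. \<integral>p. indicator (defect_set (X n)) p * f_Kurth p \<partial>lborel) \<longlonglongrightarrow> 0"
proof -
  have "(\<lambda>n. \<integral>p. indicator (defect_set (X n)) p * f_Kurth p \<partial>lborel) \<longlonglongrightarrow>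
      integral\<^sup>L lborel (\<lambda>p::(real^3) \<times> (real^3). 0)"
  proof (rule integral_dominated_convergence[OF _ _ integrable_f_Kurth])
    show "(\<lambda>p. indicator (defect_set (X n)) p * f_Kurth p) \<in> borel_measurable lborel" for n
      by measurable
    show "AE p in lborel. norm (indicator (defect_set (X n)) p * f_Kurth p) \<le> f_Kurth p" for n
      by (intro AE_I2) (auto simp: f_Kurth_nonneg indicator_def)
    have "(\<lambda>n. indicator (defect_set (X n)) p * f_Kurth p) \<longlonglongrightarrow> 0" for p
    proof (cases "f_Kurth p = 0")
      case False
      let ?s = "s_xv (fst p) (snd p)" and ?L = "norm (cross3 (fst p) (snd p))"
      from False have "0 < ?s" "?L < 1" by (auto simp: f_Kurth_alt split: if_splits)
      then have "1 - ?s < 1" "?L\<^sup>2 < 1" by (auto simp: abs_square_less_1)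
      then have "eventually (\<lambda>n. X n > 1 - ?s \<and> X n > ?L\<^sup>2) sequentially"
        by (intro eventually_conj order_tendstoD(1)[OF X(1)])
      then have "eventually (\<lambda>n. indicator (defect_set (X n)) p * f_Kurth p = 0) sequentially"
        by eventually_elim (auto simp: defect_set_def)
      then show ?thesis by (rule tendsto_eventually)
    qed simp
    then show "AE p in lborel. (\<lambda>n. indicator (defect_set (X n)) p * f_Kurth p) \<longlonglongrightarrow> 0"
      by simp
  qed simp
  then show ?thesis by simp
qed

theorem theorem1p4:
  shows "integrable lborel f_Kurth \<and>
    (\<forall>\<Gamma>\<in>{1 - 1 / 2 ^ 12..<1}. integrable lborel (f_Gamma \<Gamma>)) \<and>
    ((\<lambda>\<Gamma>. \<integral>p. \<bar>f_Gamma \<Gamma> p - f_Kurth p\<bar> \<partial>lborel) \<longlongrightarrow> 0)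
      (at 1 within {1 - 1 / 2 ^ 12..<1})"
proof (intro conjI ballI integrable_f_Kurth)
  fix \<Gamma> :: real assume "\<Gamma> \<in> {1 - 1 / 2 ^ 12..<1}"
  from Bochner_Integration.integrable_add[OF integrable_diff_f_Gamma[OF this] integrable_f_Kurth]
  show "integrable lborel (f_Gamma \<Gamma>)" by simp
next
  show "((\<lambda>\<Gamma>. \<integral>p. \<bar>f_Gamma \<Gamma> p - f_Kurth p\<bar> \<partial>lborel) \<longlongrightarrow> 0)
      (at 1 within {1 - 1 / 2 ^ 12..<1})"
    \<comment> \<open>Sequences are used because dominated convergence is applied along a
      sequence.\<close>
    unfolding tendsto_at_iff_sequentially
  proof (intro allI impI)
    fix X :: "nat \<Rightarrow> real"
    assume "\<forall>n. X n \<in> {1 - 1 / 2 ^ 12..<1} - {1}" and lim: "X \<longlonglongrightarrow> 1"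
    then have X: "X n \<in> {1 - 1 / 2 ^ 12..<1}" for n by blast
    let ?R = "\<lambda>n. 624 * kernel_bound * (1 - X n) + (\<integral>p. indicator (defect_set (X n)) p * f_Kurth p \<partial>lborel)"
    have "(\<lambda>n. \<integral>p. \<bar>f_Gamma (X n) p - f_Kurth p\<bar> \<partial>lborel) \<longlonglongrightarrow> 0"
    proof (rule tendsto_sandwich[of "\<lambda>_. 0" _ _ ?R])
      have "?R \<longlonglongrightarrow> 624 * kernel_bound * (1 - 1) + 0"
        using X by (intro tendsto_intros lim integral_f_Kurth_defect_tendsto) auto
      then show "?R \<longlonglongrightarrow> 0" by simp
      show "eventually (\<lambda>n. (\<integral>p. \<bar>f_Gamma (X n) p - f_Kurth p\<bar> \<partial>lborel) \<le> ?R n) sequentially"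
        using integral_diff_f_Gamma_le[OF X] by simp
    qed auto
    then show "((\<lambda>\<Gamma>. \<integral>p. \<bar>f_Gamma \<Gamma> p - f_Kurth p\<bar> \<partial>lborel) \<circ> X) \<longlonglongrightarrow> 0"
      by (simp add: o_def)
  qed
qed

end
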